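(* Let $p,q\in\mathbb{R}[x]$ be such that $\mathscr{W}(p)$ and $\mathscr{W}(q)$ have nonnegative, interlacing symmetric decompositions. Then $\mathscr{W}(pq)$ also has a nonnegative, interlacing symmetric decomposition.
   Context: For a polynomial $p\in\mathbb{R}[x]$ of degree $d$, $\mathscr{W}(p)$ denotes the polynomial of degree at most $d$ defined by $\sum_{j\ge0}p(j)x^j=\mathscr{W}(p)(x)/(1-x)^{d+1}$. For a polynomial $a$ of degree at most $s$ let $\mathcal{I}_s(a)(x)=x^sa(1/x)$. Every polynomial $h$ of degree at most $d$ can be written uniquely as $h=a+x\,b$ with $\mathcal{I}_d(a)=a$ and $\mathcal{I}_{d-1}(b)=b$; $(a,b)$ is the symmetric decomposition of $h$ (with respect to $d$); for $\mathscr{W}(p)$ it is taken with respect to $d=\deg p$. It is nonnegative if $a,b$ have only nonnegative coefficients. For real-rooted polynomials $a,b$ with zeros $s_k\le\cdots\le s_1$ and $t_m\le\cdots\le t_1$, we say $b$ interlaces $a$, written $b\preceq a$, if $\cdots\le t_2\le s_2\le t_1\le s_1$. The symmetric decomposition $(a,b)$ is interlacing if $a$ and $b$ are real-rooted and $b\preceq a$. *)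

theory Defs
  imports
    "HOL-Analysis.Analysis"
    "HOL-Computational_Algebra.Computational_Algebra"
begin

definition is_W_poly :: "real poly \<Rightarrow> real poly \<Rightarrow> bool" where
  "is_W_poly p w \<longleftrightarrow>
     degree w \<le> degree p \<and>
     Abs_fps (\<lambda>j. poly p (of_nat j)) = fps_of_poly w / (1 - fps_X) ^ (degree p + 1)"

definition W_poly :: "real poly \<Rightarrow> real poly" where
  "W_poly p = (THE w. is_W_poly p w)"

lemma W_poly_aux_exists:
  "degree p \<le> d \<Longrightarrow> \<exists>w. degree w \<le> d \<and>
     Abs_fps (\<lambda>j. poly (p :: real poly) (of_nat j)) * (1 - fps_X) ^ (d + 1) = fps_of_poly w"
proof (induction d arbitrary: p)
  case 0
  then obtain c where p: "p = [:c:]" by (metis degree_eq_zeroE le_zero_eq)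
  have "Abs_fps (\<lambda>j. poly p (of_nat j)) * (1 - fps_X) = fps_of_poly [:c:]"
    by (rule fps_ext) (auto simp: p algebra_simps fps_of_poly_const)
  then show ?case by (intro exI[of _ "[:c:]"]) simp
next
  case (Suc d)
  define q where "q = p - pcompose p [:-1, 1:]"
  have "degree q \<le> d"
  proof (cases "degree p = 0")
    case True
    then obtain c where "p = [:c:]" by (metis degree_eq_zeroE)
    then show ?thesis by (simp add: q_def)
  next
    case False
    have "degree q < degree p"
    proof (rule degree_lessI)
      show "\<forall>k\<ge>degree p. coeff q k = 0"
      proof (intro allI impI)
        fix k assume k: "degree p \<le> k"
        have dc: "degree (pcompose p [:-1, 1:]) = degree p"
          by (simp add: degree_pcompose)
        have lc: "lead_coeff (pcompose p [:-1, 1:]) = lead_coeff p"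
          by (subst lead_coeff_comp) auto
        show "coeff q k = 0"
          using k dc lc unfolding q_def
          by (cases "k = degree p") (auto simp: coeff_eq_0)
      qed
      show "q \<noteq> 0 \<or> 0 < degree p" using False by simp
    qed
    with Suc.prems show ?thesis by linarith
  qed
  from Suc.IH[OF this] obtain w where w: "degree w \<le> d"
    "Abs_fps (\<lambda>j. poly q (of_nat j)) * (1 - fps_X) ^ (d + 1) = fps_of_poly w" by blast
  define c where "c = poly p 0 - poly q 0"
  have step: "Abs_fps (\<lambda>j. poly p (of_nat j)) * (1 - fps_X) =
      Abs_fps (\<lambda>j. poly q (of_nat j)) + fps_const c"
  proof (rule fps_ext)
    fix n show "(Abs_fps (\<lambda>j. poly p (of_nat j)) * (1 - fps_X)) $ n =
      (Abs_fps (\<lambda>j. poly q (of_nat j)) + fps_const c) $ n"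
      by (cases n) (auto simp: q_def c_def algebra_simps poly_pcompose)
  qed
  let ?w = "w + smult c ([:1, -1:] ^ (d + 1))"
  have X: "fps_of_poly [:1, -1:] = (1 - fps_X :: real fps)"
    by (simp add: fps_of_poly_pCons)
  have "Abs_fps (\<lambda>j. poly p (of_nat j)) * (1 - fps_X) ^ (Suc d + 1) =
      (Abs_fps (\<lambda>j. poly p (of_nat j)) * (1 - fps_X)) * (1 - fps_X) ^ (d + 1)"
    by (simp add: mult.assoc)
  also have "\<dots> = fps_of_poly w + fps_const c * (1 - fps_X) ^ (d + 1)"
    unfolding step by (simp only: distrib_right w)
  also have "\<dots> = fps_of_poly ?w"
    by (simp only: fps_of_poly_add fps_of_poly_smult fps_of_poly_power X)
  finally have "Abs_fps (\<lambda>j. poly p (of_nat j)) * (1 - fps_X) ^ (Suc d + 1) = fps_of_poly ?w" .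
  moreover have "degree ?w \<le> Suc d"
  proof (rule degree_add_le)
    show "degree w \<le> Suc d" using w by simp
    have "degree ([:1, -1 :: real:] ^ (d + 1)) \<le> degree [:1, -1 :: real:] * (d + 1)"
      by (rule degree_power_le)
    then show "degree (smult c ([:1, -1:] ^ (d + 1))) \<le> Suc d"
      using degree_smult_le[of c "[:1, -1:] ^ (d + 1)"] by simp
  qed
  ultimately show ?case by blast
qed

lemma is_W_poly_iff:
  "is_W_poly p w \<longleftrightarrow> degree w \<le> degree p \<and>
     Abs_fps (\<lambda>j. poly p (of_nat j)) * (1 - fps_X) ^ (degree p + 1) = fps_of_poly w"
proof -
  have u: "((1 - fps_X :: real fps) ^ (degree p + 1)) $ 0 \<noteq> 0"
    by (simp add: fps_power_zeroth)
  show ?thesis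
    unfolding is_W_poly_def fps_divide_unit[OF u]
    by (metis (no_types, lifting) inverse_mult_eq_1 inverse_mult_eq_1' mult.assoc mult.right_neutral u)
qed

lemma is_W_poly_ex1: "\<exists>!w. is_W_poly p w"
  using W_poly_aux_exists[of p "degree p"] unfolding is_W_poly_iff
  by (metis fps_of_poly_eq_iff order_refl)

lemma is_W_poly_W_poly: "is_W_poly p (W_poly p)"
  unfolding W_poly_def by (rule theI'[OF is_W_poly_ex1])

definition recip_poly :: "nat \<Rightarrow> real poly \<Rightarrow> real poly" where
  "recip_poly s a = (\<Sum>i\<le>s. monom (coeff a i) (s - i))"

lemma coeff_recip_poly:
  "coeff (recip_poly s a) k = (if k \<le> s then coeff a (s - k) else 0)"
proof -
  have "coeff (recip_poly s a) k = (\<Sum>i\<le>s. if s - i = k then coeff a i else 0)"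
    by (simp add: recip_poly_def coeff_sum)
  also have "\<dots> = (\<Sum>i\<le>s. if i = s - k \<and> k \<le> s then coeff a i else 0)"
    by (intro sum.cong) auto
  also have "\<dots> = (if k \<le> s then coeff a (s - k) else 0)"
    by (simp add: sum.delta)
  finally show ?thesis .
qed

lemma poly_recip_poly:
  assumes "degree a \<le> s" "x \<noteq> 0"
  shows "poly (recip_poly s a) x = x ^ s * poly a (1 / x)"
proof -
  have "poly a (1 / x) = (\<Sum>i\<le>s. coeff a i * (1 / x) ^ i)"
    unfolding poly_altdef using assms(1)
    by (intro sum.mono_neutral_left) (auto simp: coeff_eq_0)
  then show ?thesis
    using assms(2)
    by (auto simp: recip_poly_def poly_sum poly_monom sum_distrib_left power_diff
        power_one_over field_simps intro!: sum.cong)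
qed

text \<open>For \<open>d = 0\<close> the second component has degree at most \<open>-1\<close>, i.e. it is zero;
  this is what the disjunction in the definition expresses.\<close>

definition symmetric_decomposition ::
    "nat \<Rightarrow> real poly \<Rightarrow> real poly \<Rightarrow> real poly \<Rightarrow> bool" where
  "symmetric_decomposition d h a b \<longleftrightarrow>
     h = a + [:0, 1:] * b \<and>
     degree a \<le> d \<and> recip_poly d a = a \<and>
     (b = 0 \<or> degree b < d) \<and> recip_poly (d - 1) b = b"

lemma symmetric_decomposition_exists:
  assumes "degree h \<le> d"
  shows "\<exists>a b. symmetric_decomposition d h a b"
proof -
  define A where "A k = (\<Sum>i<k. coeff h i)" for k
  define B where "B k = (\<Sum>i<k. coeff h (d - i))" for k
  have flip: "A (d + 1) = A k + B (d + 1 - k)" if "k \<le> d + 1" for k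
  proof -
    have "B (d + 1 - k) = (\<Sum>i\<in>{k..<d + 1}. coeff h i)"
      unfolding B_def
      by (rule sum.reindex_bij_witness[of _ "\<lambda>i. d - i" "\<lambda>i. d - i"]) (use that in auto)
    moreover have "A (d + 1) = A k + (\<Sum>i\<in>{k..<d + 1}. coeff h i)"
      unfolding A_def lessThan_atLeast0
      by (rule sum.atLeastLessThan_concat[symmetric]) (use that in auto)
    ultimately show ?thesis by simp
  qed
  define a where "a = Poly (map (\<lambda>i. A (i + 1) - B i) [0..<d + 1])"
  define b where "b = Poly (map (\<lambda>i. B (i + 1) - A (i + 1)) [0..<d])"
  have ca: "coeff a i = (if i \<le> d then A (i + 1) - B i else 0)" for i
    by (auto simp del: upt_Suc simp: a_def coeff_Poly_eq nth_default_def)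
  have cb: "coeff b i = (if i < d then B (i + 1) - A (i + 1) else 0)" for i
    by (auto simp: b_def coeff_Poly_eq nth_default_def)
  have AB: "A (d + 1) = B (d + 1)" using flip[of 0] by (simp add: A_def)
  have "h = a + [:0, 1:] * b"
  proof (rule poly_eqI)
    fix n
    show "coeff h n = coeff (a + [:0, 1:] * b) n"
    proof (cases n)
      case 0
      then show ?thesis by (simp add: ca A_def B_def)
    next
      case (Suc m)
      then show ?thesis using assms by (auto simp: ca cb A_def B_def coeff_eq_0)
    qed
  qed
  moreover have "degree a \<le> d" by (rule degree_le) (simp add: ca)
  moreover have "recip_poly d a = a"
  proof (rule poly_eqI)
    fix n
    show "coeff (recip_poly d a) n = coeff a n"
    proof (cases "n \<le> d")
      case True
      then show ?thesis
        using flip[of "n + 1"] flip[of "d - n + 1"] by (simp add: coeff_recip_poly ca)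
    qed (simp add: coeff_recip_poly ca)
  qed
  moreover have "b = 0 \<or> degree b < d"
    by (cases "d = 0") (auto simp: poly_eq_iff cb intro!: degree_lessI)
  moreover have "recip_poly (d - 1) b = b"
  proof (rule poly_eqI)
    fix n
    show "coeff (recip_poly (d - 1) b) n = coeff b n"
    proof (cases "n < d")
      case True
      then have "d - 1 - n + 1 = d - n" "d + 1 - (n + 1) = d - n" "d + 1 - (d - n) = n + 1"
        by auto
      moreover from this have "A (n + 1) + B (d - n) = A (d - n) + B (n + 1)"
        using flip[of "n + 1"] flip[of "d - n"] True by simp
      ultimately show ?thesis
        using True by (auto simp: coeff_recip_poly cb)
    qed (auto simp: coeff_recip_poly cb)
  qed
  ultimately show ?thesis unfolding symmetric_decomposition_def by blast
qed

lemma symmetric_decomposition_unique: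
  assumes "symmetric_decomposition d h a b" "symmetric_decomposition d h a' b'"
  shows "a = a' \<and> b = b'"
proof -
  define u where "u = a - a'"
  define v where "v = b - b'"
  have "a + [:0, 1:] * b = a' + [:0, 1:] * b'"
    using assms unfolding symmetric_decomposition_def by metis
  then have eq: "u + [:0, 1:] * v = 0"
    unfolding u_def v_def right_diff_distrib by (simp only: diff_add_eq add_diff_eq)
  have ra: "coeff u k = coeff u (d - k)" if "k \<le> d" for k
    using assms that coeff_recip_poly[of d a k] coeff_recip_poly[of d a' k]
    by (simp add: symmetric_decomposition_def u_def)
  have rb: "coeff v k = coeff v (d - 1 - k)" if "k < d" for k
    using assms that coeff_recip_poly[of "d - 1" b k] coeff_recip_poly[of "d - 1" b' k]
    by (auto simp: symmetric_decomposition_def v_def)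
  have v0: "coeff v k = 0" if "d \<le> k" for k
    using assms that by (auto simp: symmetric_decomposition_def v_def coeff_eq_0)
  have u0: "coeff u 0 = 0" using arg_cong[OF eq, of "\<lambda>r. coeff r 0"] by simp
  have uS: "coeff u (Suc k) = - coeff v k" for k
    using arg_cong[OF eq, of "\<lambda>r. coeff r (Suc k)"] by simp
  have "coeff u k = 0 \<and> coeff v k = 0" if "k < d" for k
    using that
  proof (induction k)
    case 0
    have "coeff v (d - 1) = - coeff u d" using uS[of "d - 1"] 0 by simp
    with 0 show ?case using ra[of 0] rb[of 0] u0 by simp
  next
    case (Suc k)
    have 1: "coeff u (Suc k) = 0" using uS[of k] Suc by simp
    have "coeff v (Suc k) = coeff v (d - 1 - Suc k)" using rb Suc.prems by blast
    also have "\<dots> = - coeff u (d - Suc k)"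
      using uS[of "d - 1 - Suc k"] Suc.prems by (simp add: Suc_diff_Suc)
    also have "\<dots> = 0" using ra[of "Suc k"] Suc.prems 1 by simp
    finally show ?case using 1 by simp
  qed
  with v0 have "v = 0" by (metis leading_coeff_0_iff not_less)
  with eq show ?thesis by (simp add: u_def v_def)
qed

definition nonneg_coeffs :: "real poly \<Rightarrow> bool" where
  "nonneg_coeffs a \<longleftrightarrow> (\<forall>i. 0 \<le> coeff a i)"

text \<open>The zero polynomial counts as real-rooted.\<close>

definition real_rooted :: "real poly \<Rightarrow> bool" where
  "real_rooted a \<longleftrightarrow>
     a = 0 \<or> (\<forall>z :: complex. poly (map_poly of_real a) z = 0 \<longrightarrow> z \<in> \<real>)"

definition zeros_desc :: "real poly \<Rightarrow> real list" where
  "zeros_desc a = rev (sorted_list_of_multiset (proots a))"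

text \<open>\<open>interlaces b a\<close> is \<open>b \<preceq> a\<close>; the largest zero belongs to \<open>a\<close>. The alternating chain of
  inequalities forces \<open>a\<close> to have as many zeros as \<open>b\<close> or exactly one more. By the usual
  convention the zero polynomial interlaces, and is interlaced by, every real-rooted
  polynomial; for instance the decomposition of a palindromic polynomial has \<open>b = 0\<close>.\<close>

definition interlaces :: "real poly \<Rightarrow> real poly \<Rightarrow> bool" where
  "interlaces b a \<longleftrightarrow> real_rooted a \<and> real_rooted b \<and>
     (a = 0 \<or> b = 0 \<or>
       (let s = zeros_desc a; t = zeros_desc b in
          (length s = length t \<or> length s = length t + 1) \<and>
          (\<forall>i < length t. t ! i \<le> s ! i) \<and>
          (\<forall>i < length t. i + 1 < length s \<longrightarrow> s ! (i + 1) \<le> t ! i)))"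

definition nonneg_interlacing_decomposition :: "nat \<Rightarrow> real poly \<Rightarrow> bool" where
  "nonneg_interlacing_decomposition d h \<longleftrightarrow>
     (\<exists>a b. symmetric_decomposition d h a b \<and>
            nonneg_coeffs a \<and> nonneg_coeffs b \<and> interlaces b a)"

end

theory Submission
  imports Defs
begin

text \<open>
  Write \<open>h = W(p) = a + x b\<close> and \<open>h* = I\<^sub>d(h) = a + b\<close>, and likewise \<open>k\<close>, \<open>k*\<close> for \<open>q\<close>. For nonnegative \<open>a\<close>
  and \<open>b\<close>, the relation \<open>b \<preceq> a\<close> implies that \<open>h/h*\<close> maps every point \<open>Y\<close> of the upper half-plane into the
  cone spanned by \<open>1\<close> and \<open>Y\<close>.

  The value at \<open>y\<close> of \<open>\<Theta>(h, k) = W(pq)\<close> is the coefficient of \<open>s\<^bsup>e\<^esup>\<close> in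
  \<open>(1 + s)\<^bsup>d\<^esup> (y + s)\<^bsup>e\<^esup> h(Y) k(y/Y)\<close>, where \<open>Y = (y + s) / (1 + s)\<close>. For \<open>y\<close> in the upper half-plane, the cone
  condition keeps \<open>h k / (h* k*)\<close>, evaluated at \<open>Y\<close> and \<open>y/Y\<close>, off the negative real axis as long as \<open>Y\<close>
  is in the upper half-plane. By Gauss--Lucas, no convex combination of \<open>\<Theta>(h, k)\<close> and \<open>\<Theta>(h*, k*)\<close>, which
  is \<open>I\<^sub>d\<^sub>+\<^sub>e(\<Theta>(h, k))\<close>, vanishes in the upper half-plane. The same argument gives
  \<open>\<Theta>(h*, k*) \<preceq> \<Theta>(h*, k) \<preceq> \<Theta>(h, k)\<close>. A continuity argument for the argument of the quotient combines these
  facts into \<open>\<Theta>(h*, k*) \<preceq> \<Theta>(h, k)\<close>, that is, \<open>I\<^sub>d\<^sub>+\<^sub>e(W(pq)) \<preceq> W(pq)\<close>.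

  If \<open>(a, b)\<close> now denotes the symmetric decomposition of \<open>W = W(pq)\<close> and \<open>W* = a + b\<close>, then
  \<open>(x - 1) b = W - W*\<close> and \<open>(x - 1) a = x W* - W\<close>, and removing the largest zero \<open>1\<close> from these
  differences yields that \<open>a\<close> and \<open>b\<close> are nonnegative and real-rooted with \<open>b \<preceq> W*\<close>, hence \<open>b \<preceq> a\<close>.
\<close>

section \<open>Numerators of Hadamard products\<close>

lemma sum_choose_mult_choose:
  fixes \<alpha> \<beta> j n :: nat
  assumes "j \<le> n"
  shows "(\<Sum>k\<le>n. (\<alpha> choose k) * (\<beta> choose (n - k)) * (k choose j)) =
    (\<alpha> choose j) * ((\<alpha> + \<beta> - j) choose (n - j))"
proof (cases "j \<le> \<alpha>")
  case True
  \<comment> \<open>Trinomial revision takes \<open>\<alpha> choose j\<close> out of the sum; a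
    Vandermonde convolution shifted by \<open>j\<close> remains.\<close>
  have eq: "(\<alpha> choose k) * (k choose j) = (\<alpha> choose j) * ((\<alpha> - j) choose (k - j))" if "j \<le> k" for k
    using that True by (cases "k \<le> \<alpha>") (auto simp: choose_mult binomial_eq_0)
  have "(\<Sum>k\<le>n. (\<alpha> choose k) * (\<beta> choose (n - k)) * (k choose j)) =
    (\<Sum>k\<in>{j..n}. (\<alpha> choose k) * (\<beta> choose (n - k)) * (k choose j))"
    by (rule sum.mono_neutral_right) auto
  also have "\<dots> = (\<Sum>k\<in>{j..n}. (\<alpha> choose j) * (((\<alpha> - j) choose (k - j)) * (\<beta> choose (n - k))))"
  proof (rule sum.cong)
    fix k assume "k \<in> {j..n}"
    then have "(\<beta> choose (n - k)) * ((\<alpha> choose k) * (k choose j)) =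
        (\<beta> choose (n - k)) * ((\<alpha> choose j) * ((\<alpha> - j) choose (k - j)))"
      by (simp only: eq atLeastAtMost_iff)
    then show "(\<alpha> choose k) * (\<beta> choose (n - k)) * (k choose j) =
        (\<alpha> choose j) * (((\<alpha> - j) choose (k - j)) * (\<beta> choose (n - k)))"
      by (simp only: mult_ac)
  qed simp
  also have "\<dots> = (\<alpha> choose j) * (\<Sum>k\<in>{j..n}. ((\<alpha> - j) choose (k - j)) * (\<beta> choose (n - k)))"
    by (simp add: sum_distrib_left)
  also have "(\<Sum>k\<in>{j..n}. ((\<alpha> - j) choose (k - j)) * (\<beta> choose (n - k))) =
    (\<Sum>k\<le>n - j. ((\<alpha> - j) choose k) * (\<beta> choose (n - j - k)))"
    by (rule sum.reindex_bij_witness[of _ "\<lambda>k. k + j" "\<lambda>k. k - j"]) (use assms in auto)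
  also have "\<dots> = (\<alpha> - j + \<beta>) choose (n - j)"
    by (rule vandermonde)
  finally show ?thesis using True by simp
next
  case False
  have z: "(\<alpha> choose k) * (\<beta> choose (n - k)) * (k choose j) = 0" for k
    using False by (cases "k < j") auto
  show ?thesis using False by (simp only: z) simp
qed

text \<open>Vandermonde expands \<open>(x + k) choose (m + n)\<close> in the binomials
  \<open>k choose j\<close>; after exchanging the sums, \<open>sum_choose_mult_choose\<close>
  evaluates the inner one, and trinomial revision with a second Vandermonde convolution factors the
  rest.\<close>

lemma nanjundiah:
  fixes m n x y \<alpha> \<beta> :: nat
  assumes "\<alpha> + \<beta> = m + n" "m + y = x + \<alpha>"
  shows "(\<Sum>k\<le>n. (\<alpha> choose k) * (\<beta> choose (n - k)) * ((x + k) choose (m + n))) =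
    (x choose m) * (y choose n)"
proof -
  have e1: "(x + k) choose (m + n) = (\<Sum>j\<le>n. (k choose j) * (x choose (m + n - j)))" if "k \<le> n" for k
  proof -
    have "(x + k) choose (m + n) = (\<Sum>j\<le>m + n. (k choose j) * (x choose (m + n - j)))"
      by (simp add: vandermonde add.commute)
    also have "\<dots> = (\<Sum>j\<le>n. (k choose j) * (x choose (m + n - j)))"
      by (rule sum.mono_neutral_right) (use that in auto)
    finally show ?thesis .
  qed
  have e3: "(x choose (m + n - j)) * ((m + n - j) choose (n - j)) = (x choose m) * ((x - m) choose (n - j))"
    if "j \<le> n" for j
  proof -
    have "(m + n - j) choose (n - j) = (m + n - j) choose m"
      using that binomial_symmetric[of "n - j" "m + n - j"] by simp
    then show ?thesis using that by (cases "m + n - j \<le> x") (auto simp: choose_mult binomial_eq_0)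
  qed
  have "(\<Sum>k\<le>n. (\<alpha> choose k) * (\<beta> choose (n - k)) * ((x + k) choose (m + n))) =
    (\<Sum>k\<le>n. \<Sum>j\<le>n. (x choose (m + n - j)) * ((\<alpha> choose k) * (\<beta> choose (n - k)) * (k choose j)))"
    by (intro sum.cong) (simp_all add: e1 sum_distrib_left mult_ac)
  also have "\<dots> = (\<Sum>j\<le>n. (x choose (m + n - j)) * (\<Sum>k\<le>n. (\<alpha> choose k) * (\<beta> choose (n - k)) * (k choose j)))"
    by (subst sum.swap) (simp add: sum_distrib_left)
  also have "\<dots> = (\<Sum>j\<le>n. (\<alpha> choose j) * ((x choose (m + n - j)) * ((m + n - j) choose (n - j))))"
    by (intro sum.cong) (simp_all add: sum_choose_mult_choose assms)
  also have "\<dots> = (\<Sum>j\<le>n. (x choose m) * ((\<alpha> choose j) * ((x - m) choose (n - j))))"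
    by (intro sum.cong) (simp_all add: e3 mult_ac)
  also have "\<dots> = (x choose m) * ((\<alpha> + (x - m)) choose n)"
    by (simp flip: sum_distrib_left add: vandermonde)
  \<comment> \<open>For \<open>x < m\<close> the difference \<open>x - m\<close> truncates, but then
    the factor \<open>x choose m\<close> is 0.\<close>
  also have "\<dots> = (x choose m) * (y choose n)"
  proof (cases "m \<le> x")
    case True
    then have "\<alpha> + (x - m) = y" using assms by simp
    then show ?thesis by simp
  qed simp
  finally show ?thesis .
qed

section \<open>Coefficient sequences and Hadamard numerators\<close>

text \<open>The coefficient sequence of \<open>w / (1 - x)\<^bsup>D + 1\<^esup>\<close> for \<open>w\<close> of degree at most \<open>D\<close>.\<close>

definition num_seq :: "nat \<Rightarrow> real poly \<Rightarrow> nat \<Rightarrow> real" where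
  "num_seq D w n = (\<Sum>m\<le>D. coeff w m * of_nat ((n + D - m) choose D))"

text \<open>By Pascal's rule, multiplication by \<open>1 - fps_X\<close> lowers \<open>D\<close> by
  one.\<close>

lemma fps_choose_mult_one_minus_X_power:
  "Abs_fps (\<lambda>n. of_nat ((n + D) choose D)) * (1 - fps_X) ^ (D + 1) = (1 :: real fps)"
proof (induction D)
  case 0
  show ?case by (rule fps_ext) (simp add: algebra_simps)
next
  case (Suc D)
  have "Abs_fps (\<lambda>n. of_nat ((n + Suc D) choose Suc D)) * (1 - fps_X) =
    (Abs_fps (\<lambda>n. of_nat ((n + D) choose D)) :: real fps)"
  proof (rule fps_ext)
    fix n
    show "fps_nth (Abs_fps (\<lambda>n. of_nat ((n + Suc D) choose Suc D)) * (1 - fps_X)) n =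
      fps_nth (Abs_fps (\<lambda>n. of_nat ((n + D) choose D)) :: real fps) n"
      by (cases n) (simp_all add: algebra_simps)
  qed
  then show ?case using Suc by (simp add: mult.assoc[symmetric])
qed

lemma num_seq_fps:
  assumes "degree w \<le> D"
  shows "Abs_fps (num_seq D w) * (1 - fps_X) ^ (D + 1) = fps_of_poly w"
proof -
  have "Abs_fps (num_seq D w) = fps_of_poly w * Abs_fps (\<lambda>n. of_nat ((n + D) choose D))"
  proof (rule fps_ext)
    fix n
    \<comment> \<open>For \<open>n < m \<le> D\<close> the upper index \<open>n + D - m\<close> is
      below \<open>D\<close>, so the binomial vanishes; for \<open>m > D\<close> the coefficient
      does. Hence the sum is the Cauchy product.\<close>
    have "num_seq D w n = (\<Sum>m\<in>{0..n}. coeff w m * of_nat ((n + D - m) choose D))"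
      unfolding num_seq_def
      by (rule sum.mono_neutral_cong) (use assms in \<open>auto simp: coeff_eq_0\<close>)
    then show "fps_nth (Abs_fps (num_seq D w)) n = fps_nth (fps_of_poly w * Abs_fps (\<lambda>n. of_nat ((n + D) choose D))) n"
      by (simp add: fps_mult_nth)
  qed
  then show ?thesis
    by (simp only: mult.assoc fps_choose_mult_one_minus_X_power mult_1_right)
qed

lemma num_seq_inj:
  assumes "degree v \<le> D" "degree w \<le> D" "\<And>n. num_seq D v n = num_seq D w n"
  shows "v = w"
proof -
  have "num_seq D v = num_seq D w" using assms by auto
  then show ?thesis using num_seq_fps[OF assms(1)] num_seq_fps[OF assms(2)] by (simp add: fps_of_poly_eq_iff)
qed

lemma W_poly_eqI:
  assumes "degree w \<le> degree p" "\<And>n. poly p (of_nat n) = num_seq (degree p) w n"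
  shows "W_poly p = w"
proof -
  have "is_W_poly p w"
    using num_seq_fps[OF assms(1)] assms by (simp add: is_W_poly_iff)
  then show ?thesis using is_W_poly_W_poly is_W_poly_ex1 by blast
qed

lemma degree_W_poly: "degree (W_poly p) \<le> degree p"
  using is_W_poly_W_poly[of p] by (simp add: is_W_poly_def)

lemma poly_eq_num_seq_W_poly: "poly p (of_nat n) = num_seq (degree p) (W_poly p) n"
proof -
  have "Abs_fps (\<lambda>j. poly p (of_nat j)) * (1 - fps_X) ^ (degree p + 1) =
    Abs_fps (num_seq (degree p) (W_poly p)) * (1 - fps_X) ^ (degree p + 1)"
    using is_W_poly_W_poly[of p] num_seq_fps[OF degree_W_poly[of p]] by (simp add: is_W_poly_iff)
  moreover have "(1 - fps_X :: real fps) ^ (degree p + 1) \<noteq> 0"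
    by (metis fps_choose_mult_one_minus_X_power mult_zero_right zero_neq_one)
  ultimately have "Abs_fps (\<lambda>j. poly p (of_nat j)) = Abs_fps (num_seq (degree p) (W_poly p))"
    by (metis mult_right_cancel)
  then show ?thesis by (simp add: fps_eq_iff)
qed

text \<open>The numerator of the Hadamard product of \<open>x\<^bsup>i\<^esup> / (1 - x)\<^bsup>d + 1\<^esup>\<close> and \<open>x\<^bsup>j\<^esup> / (1 - x)\<^bsup>e + 1\<^esup>\<close>, as given by
  Nanjundiah's identity. The subtractions do not truncate for \<open>i \<le> d\<close> and \<open>j \<le> e\<close>.\<close>

definition hadamard_term :: "nat \<Rightarrow> nat \<Rightarrow> nat \<Rightarrow> nat \<Rightarrow> real poly" where
  "hadamard_term d e i j =
    (\<Sum>l\<le>e. monom (of_nat (((e + i - j) choose (e - l)) * ((d + j - i) choose l))) (i + l))"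

definition hadamard_num :: "nat \<Rightarrow> nat \<Rightarrow> real poly \<Rightarrow> real poly \<Rightarrow> real poly" where
  "hadamard_num d e h k =
    (\<Sum>i\<le>d. \<Sum>j\<le>e. smult (coeff h i * coeff k j) (hadamard_term d e i j))"

lemma degree_hadamard_num: "degree (hadamard_num d e h k) \<le> d + e"
  unfolding hadamard_num_def hadamard_term_def
  by (intro degree_sum_le order.trans[OF degree_smult_le] order.trans[OF degree_monom_le]) auto

lemma num_seq_smult: "num_seq D (smult c w) n = c * num_seq D w n"
  by (simp add: num_seq_def sum_distrib_left mult_ac)

lemma num_seq_sum: "num_seq D (\<Sum>i\<in>A. f i) n = (\<Sum>i\<in>A. num_seq D (f i) n)"
  unfolding num_seq_def coeff_sum sum_distrib_right by (rule sum.swap)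

lemma num_seq_monom: "m \<le> D \<Longrightarrow> num_seq D (monom c m) n = c * of_nat ((n + D - m) choose D)"
  by (simp add: num_seq_def if_distrib[of "\<lambda>x. x * _"] cong: if_cong)

text \<open>Reversing \<open>l\<close> gives the left side of \<open>nanjundiah\<close> with
  \<alpha> = \<open>e + i - j\<close>, \<beta> = \<open>d + j - i\<close>, x =
  \<open>n + d - i\<close> and y = \<open>n + e - j\<close>.\<close>

lemma num_seq_hadamard_term:
  assumes "i \<le> d" "j \<le> e"
  shows "num_seq (d + e) (hadamard_term d e i j) n =
    of_nat ((n + d - i) choose d) * of_nat ((n + e - j) choose e)"
proof -
  have "num_seq (d + e) (hadamard_term d e i j) n =
    of_nat (\<Sum>l\<le>e. ((e + i - j) choose (e - l)) * ((d + j - i) choose l) * ((n + (d + e) - (i + l)) choose (d + e)))"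
    using assms unfolding hadamard_term_def num_seq_sum by (simp add: num_seq_monom add.assoc)
  also have "(\<Sum>l\<le>e. ((e + i - j) choose (e - l)) * ((d + j - i) choose l) * ((n + (d + e) - (i + l)) choose (d + e))) =
    (\<Sum>l\<le>e. ((e + i - j) choose l) * ((d + j - i) choose (e - l)) * (((n + d - i) + l) choose (d + e)))"
    by (rule sum.reindex_bij_witness[of _ "\<lambda>l. e - l" "\<lambda>l. e - l"]) (use assms in \<open>auto simp: add.assoc\<close>)
  also have "\<dots> = ((n + d - i) choose d) * ((n + e - j) choose e)"
    by (rule nanjundiah) (use assms in auto)
  finally show ?thesis by simp
qed

lemma num_seq_hadamard_num:
  "num_seq (d + e) (hadamard_num d e h k) n = num_seq d h n * num_seq e k n"
proof -
  have "num_seq (d + e) (hadamard_num d e h k) n =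
    (\<Sum>i\<le>d. \<Sum>j\<le>e. coeff h i * coeff k j * (of_nat ((n + d - i) choose d) * of_nat ((n + e - j) choose e)))"
    unfolding hadamard_num_def num_seq_sum num_seq_smult
    by (intro sum.cong) (simp_all add: num_seq_hadamard_term)
  then show ?thesis by (simp add: num_seq_def sum_product mult_ac)
qed

text \<open>Values of \<open>p * q\<close> are products of values, so the numerators combine as for
  a Hadamard product; nonzero factors make the degrees add.\<close>

lemma W_poly_mult:
  assumes "p \<noteq> 0" "q \<noteq> 0"
  shows "W_poly (p * q) = hadamard_num (degree p) (degree q) (W_poly p) (W_poly q)"
proof (rule W_poly_eqI)
  show "degree (hadamard_num (degree p) (degree q) (W_poly p) (W_poly q)) \<le> degree (p * q)"
    using assms by (simp add: degree_mult_eq degree_hadamard_num)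
  show "poly (p * q) (of_nat n) =
      num_seq (degree (p * q)) (hadamard_num (degree p) (degree q) (W_poly p) (W_poly q)) n" for n
    unfolding degree_mult_eq[OF assms] num_seq_hadamard_num poly_mult
    by (simp only: poly_eq_num_seq_W_poly)
qed

section \<open>Symmetries of the Hadamard numerator\<close>

text \<open>The formula is asymmetric, but both sides have the same coefficient sequence, which
  determines the polynomial. This transfers results about the first argument to the second.\<close>

lemma hadamard_num_commute: "hadamard_num d e h k = hadamard_num e d k h"
  by (rule num_seq_inj[of _ "d + e"])
    (use degree_hadamard_num[of e d k h] num_seq_hadamard_num[of e d k h] in
      \<open>simp_all add: degree_hadamard_num num_seq_hadamard_num add.commute mult.commute\<close>)

text \<open>The reversed exponent of \<open>i + l\<close> is \<open>(d - i) + (e - l)\<close>;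
  replacing \<open>l\<close> by \<open>e - l\<close> makes the two binomials trade places.\<close>

lemma recip_poly_hadamard_term:
  assumes "i \<le> d" "j \<le> e"
  shows "recip_poly (d + e) (hadamard_term d e i j) = hadamard_term d e (d - i) (e - j)"
proof (rule poly_eqI)
  fix n
  have c: "coeff (hadamard_term d e i' j') m =
      (\<Sum>l\<le>e. if i' + l = m then of_nat (((e + i' - j') choose (e - l)) * ((d + j' - i') choose l)) else 0)"
    for i' j' m unfolding hadamard_term_def coeff_sum coeff_monom ..
  have a: "e + (d - i) - (e - j) = d + j - i" "d + (e - j) - (d - i) = e + i - j" using assms by auto
  show "coeff (recip_poly (d + e) (hadamard_term d e i j)) n = coeff (hadamard_term d e (d - i) (e - j)) n"
  proof (cases "n \<le> d + e")
    case True
    then show ?thesis unfolding coeff_recip_poly c a using True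
      by (simp, intro sum.reindex_bij_witness[of _ "\<lambda>l. e - l" "\<lambda>l. e - l"]) (use assms in auto)
  next
    case False
    then have "(\<Sum>l\<le>e. if d - i + l = n then real ((d + j - i choose (e - l)) * (e + i - j choose l)) else 0) = 0"
      by (intro sum.neutral) auto
    with False show ?thesis unfolding coeff_recip_poly c a by simp
  qed
qed

lemma recip_poly_add: "recip_poly s (a + b) = recip_poly s a + recip_poly s b"
  by (simp add: poly_eq_iff coeff_recip_poly)

lemma recip_poly_smult: "recip_poly s (smult c a) = smult c (recip_poly s a)"
  by (simp add: poly_eq_iff coeff_recip_poly)

lemma recip_poly_sum: "recip_poly s (\<Sum>i\<in>A. f i) = (\<Sum>i\<in>A. recip_poly s (f i))"
  by (simp add: poly_eq_iff coeff_recip_poly coeff_sum)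

lemma recip_poly_hadamard_num:
  "recip_poly (d + e) (hadamard_num d e h k) = hadamard_num d e (recip_poly d h) (recip_poly e k)"
proof -
  have "recip_poly (d + e) (hadamard_num d e h k) =
    (\<Sum>i\<le>d. \<Sum>j\<le>e. smult (coeff h i * coeff k j) (hadamard_term d e (d - i) (e - j)))"
    unfolding hadamard_num_def recip_poly_sum recip_poly_smult
    by (intro sum.cong) (simp_all add: recip_poly_hadamard_term)
  also have "\<dots> = (\<Sum>i\<le>d. \<Sum>j\<le>e. smult (coeff h (d - i) * coeff k (e - j)) (hadamard_term d e i j))"
    by (rule sum.reindex_bij_witness[of _ "\<lambda>i. d - i" "\<lambda>i. d - i"];
        (rule sum.reindex_bij_witness[of _ "\<lambda>j. e - j" "\<lambda>j. e - j"])?) auto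
  finally show ?thesis by (simp add: hadamard_num_def coeff_recip_poly)
qed

lemma nonneg_coeffs_hadamard_num:
  "nonneg_coeffs h \<Longrightarrow> nonneg_coeffs k \<Longrightarrow> nonneg_coeffs (hadamard_num d e h k)"
  unfolding nonneg_coeffs_def hadamard_num_def hadamard_term_def coeff_sum coeff_smult coeff_monom
  by (intro allI sum_nonneg mult_nonneg_nonneg) auto

section \<open>Zeros in half-planes\<close>

text \<open>This is the logarithmic derivative, the sum of all \<open>1 / (s - r)\<close>, without
  division. With \<open>c\<close> taken out, every term \<open>1 / (c * (s - r))\<close> has
  negative imaginary part, so the terms cannot cancel.\<close>

lemma poly_pderiv_prod_linear_halfplane:
  fixes c s :: complex
  assumes "\<And>r. r \<in> set rs \<Longrightarrow> Im (c * r) < 0" "Im (c * s) \<ge> 0"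
  shows "\<exists>S. poly (pderiv (\<Prod>r\<leftarrow>rs. [:-r, 1:])) s = poly (\<Prod>r\<leftarrow>rs. [:-r, 1:]) s * (c * S) \<and>
    (if rs = [] then S = 0 else Im S < 0)"
  using assms(1)
proof (induction rs)
  case Nil
  show ?case by (simp add: pderiv_1)
next
  case (Cons r rs)
  let ?P = "\<Prod>r\<leftarrow>rs. [:-r, 1:]"
  obtain S where S: "poly (pderiv ?P) s = poly ?P s * (c * S)" "if rs = [] then S = 0 else Im S < 0"
    using Cons by auto
  have "Im (c * r) < 0" using Cons.prems by simp
  then have pos: "Im (c * (s - r)) > 0" using assms(2) by (simp add: right_diff_distrib)
  then have nz: "c \<noteq> 0" "s - r \<noteq> 0" by auto
  have im: "Im (1 / (c * (s - r))) < 0"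
    using pos by (simp only: Im_divide) (simp add: divide_neg_pos sum_power2_gt_zero_iff)
  have "poly (pderiv ([:-r, 1:] * ?P)) s = poly ([:-r, 1:] * ?P) s * (c * (S + 1 / (c * (s - r))))"
    unfolding pderiv_mult poly_add poly_mult S(1) using nz by (simp add: pderiv_pCons field_simps)
  moreover have "Im (S + 1 / (c * (s - r))) < 0" using S(2) im by (auto split: if_splits)
  ultimately show ?case by auto
qed

text \<open>At \<open>s\<close> the polynomial does not vanish, and its logarithmic derivative is
  \<open>c\<close> times a number of negative imaginary part.\<close>

lemma gauss_lucas_halfplane:
  fixes K :: "complex poly"
  assumes "\<And>s. poly K s = 0 \<Longrightarrow> Im (c * s) < 0" "degree K > 0" "Im (c * s) \<ge> 0"
  shows "poly (pderiv K) s \<noteq> 0"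
proof -
  obtain rs where mset_rs: "mset rs = proots K"
    using ex_mset by blast
  have rs: "smult (lead_coeff K) (\<Prod>r\<leftarrow>rs. [:-r, 1:]) = K"
    using complex_poly_decompose_multiset[of K] by (simp flip: mset_rs prod_mset_prod_list)
  have "length rs = degree K"
    using size_proots_complex[of K] by (simp flip: mset_rs)
  have "K \<noteq> 0" using assms(2) by auto
  have "set rs = {r. poly K r = 0}"
    using set_count_proots[OF \<open>K \<noteq> 0\<close>] by (simp flip: mset_rs)
  then have root: "Im (c * r) < 0" if "r \<in> set rs" for r
    using that assms(1) by auto
  obtain S where S: "poly (pderiv (\<Prod>r\<leftarrow>rs. [:-r, 1:])) s = poly (\<Prod>r\<leftarrow>rs. [:-r, 1:]) s * (c * S)"
    "if rs = [] then S = 0 else Im S < 0"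
    using poly_pderiv_prod_linear_halfplane[OF root assms(3)] by blast
  have ne: "rs \<noteq> []" using \<open>length rs = degree K\<close> assms(2) by auto
  have "S \<noteq> 0" using S(2) ne by auto
  have "c \<noteq> 0" using root[of "hd rs"] ne by auto
  have "poly (pderiv K) s = poly (smult (lead_coeff K) (\<Prod>r\<leftarrow>rs. [:-r, 1:])) s * (c * S)"
    by (subst rs[symmetric]) (simp only: pderiv_smult poly_smult S(1) mult.assoc)
  then have "poly (pderiv K) s = poly K s * (c * S)" by (simp only: rs)
  moreover have "poly K s \<noteq> 0" using assms(1,3) by fastforce
  ultimately show ?thesis using \<open>S \<noteq> 0\<close> \<open>c \<noteq> 0\<close> by simp
qed

text \<open>Up to a positive factor, the coefficient is the value at 0 of the \<open>m\<close>-th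
  derivative. Gauss--Lucas keeps the zeros of all derivatives in the open half-plane, and 0 lies on
  its boundary.\<close>

lemma coeff_nonzero_of_roots_halfplane:
  fixes K :: "complex poly"
  assumes "\<And>s. poly K s = 0 \<Longrightarrow> Im (c * s) < 0" "K \<noteq> 0" "m \<le> degree K"
  shows "coeff K m \<noteq> 0"
  using assms
proof (induction m arbitrary: K)
  case 0
  show ?case using 0(1)[of 0] by (auto simp: poly_0_coeff_0)
next
  case (Suc m)
  have "coeff (pderiv K) m \<noteq> 0"
  proof (rule Suc.IH)
    show "Im (c * s) < 0" if "poly (pderiv K) s = 0" for s
      using gauss_lucas_halfplane[of K c s] Suc.prems that by force
    show "pderiv K \<noteq> 0" using Suc.prems by (auto simp: pderiv_eq_0_iff)
    show "m \<le> degree (pderiv K)" using Suc.prems by (simp add: degree_pderiv)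
  qed
  then show ?case by (auto simp: coeff_pderiv)
qed

section \<open>Real polynomials as complex functions\<close>

definition cpoly :: "real poly \<Rightarrow> complex poly" where
  "cpoly = map_poly complex_of_real"

lemma coeff_cpoly [simp]: "coeff (cpoly a) i = of_real (coeff a i)"
  by (simp add: cpoly_def coeff_map_poly)

lemma cpoly_add [simp]: "cpoly (a + b) = cpoly a + cpoly b"
  by (simp add: poly_eq_iff)

lemma cpoly_diff [simp]: "cpoly (a - b) = cpoly a - cpoly b"
  by (simp add: poly_eq_iff)

lemma cpoly_mult [simp]: "cpoly (a * b) = cpoly a * cpoly b"
  by (simp add: poly_eq_iff coeff_mult)

lemma cpoly_smult [simp]: "cpoly (smult c a) = smult (of_real c) (cpoly a)"
  by (simp add: poly_eq_iff)

lemma cpoly_minus [simp]: "cpoly (- a) = - cpoly a"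
  by (simp add: poly_eq_iff)

lemma cpoly_0 [simp]: "cpoly 0 = 0"
  by (simp add: cpoly_def)

lemma cpoly_1 [simp]: "cpoly 1 = 1"
  by (simp add: cpoly_def)

lemma cpoly_pCons [simp]: "cpoly (pCons c a) = pCons (of_real c) (cpoly a)"
  by (simp add: cpoly_def map_poly_pCons)

lemma cpoly_sum [simp]: "cpoly (\<Sum>i\<in>A. f i) = (\<Sum>i\<in>A. cpoly (f i))"
  by (simp add: poly_eq_iff coeff_sum)

lemma cpoly_monom [simp]: "cpoly (monom c n) = monom (of_real c) n"
  by (simp add: cpoly_def map_poly_monom)

lemma degree_cpoly [simp]: "degree (cpoly a) = degree a"
  by (simp add: cpoly_def degree_map_poly)

lemma cpoly_of_real: "poly (cpoly a) (of_real x) = of_real (poly a x)"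
  by (induction a) simp_all

lemma cpoly_cnj: "poly (cpoly a) (cnj z) = cnj (poly (cpoly a) z)"
  by (induction a) simp_all

lemma cpoly_altdef:
  assumes "degree a \<le> d"
  shows "poly (cpoly a) z = (\<Sum>i\<le>d. of_real (coeff a i) * z ^ i)"
proof -
  have "poly (cpoly a) z = (\<Sum>i\<le>degree a. of_real (coeff a i) * z ^ i)"
    by (simp add: poly_altdef)
  also have "\<dots> = (\<Sum>i\<le>d. of_real (coeff a i) * z ^ i)"
    by (rule sum.mono_neutral_left) (use assms in \<open>auto simp: coeff_eq_0\<close>)
  finally show ?thesis .
qed

section \<open>The auxiliary polynomial in \<open>s\<close>\<close>

text \<open>A polynomial in an auxiliary variable \<open>s\<close> with parameter \<open>y\<close>; away from \<open>s = -1\<close> and \<open>s = -y\<close> it is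
  \<open>(1 + s)\<^bsup>d\<^esup> (y + s)\<^bsup>e\<^esup> h(Y) k(y / Y)\<close> with \<open>Y = (y + s) / (1 + s)\<close>, and its \<open>e\<close>-th coefficient is
  the numerator of the Hadamard product at \<open>y\<close>.\<close>

definition conv_poly :: "nat \<Rightarrow> nat \<Rightarrow> real poly \<Rightarrow> real poly \<Rightarrow> complex \<Rightarrow> complex poly" where
  "conv_poly d e h k y = (\<Sum>i\<le>d. \<Sum>j\<le>e. smult (of_real (coeff h i) * of_real (coeff k j) * y ^ j)
    ([:y, 1:] ^ (e + i - j) * [:1, 1:] ^ (d + j - i)))"

lemma coeff_linear_power':
  "coeff ([:a, 1:] ^ n) i = of_nat (n choose i) * (a :: 'a :: comm_semiring_1) ^ (n - i)"
proof (cases "i \<le> n")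
  case True
  then show ?thesis by (simp add: coeff_linear_poly_power)
next
  case False
  have "degree ([:a, 1:] ^ n) \<le> n"
    using degree_power_le[of "[:a, 1:]" n] by (rule order_trans) simp
  then have "coeff ([:a, 1:] ^ n) i = 0" using False by (intro coeff_eq_0) simp
  then show ?thesis using False by (simp add: binomial_eq_0)
qed

lemma coeff_conv_poly:
  "coeff (conv_poly d e h k y) e = poly (cpoly (hadamard_num d e h k)) y"
proof -
  have *: "y ^ j * coeff ([:y, 1:] ^ (e + i - j) * [:1, 1:] ^ (d + j - i)) e =
      poly (cpoly (hadamard_term d e i j)) y" if "j \<le> e" for i j
  proof -
    have "y ^ j * coeff ([:y, 1:] ^ (e + i - j) * [:1, 1:] ^ (d + j - i)) e =
      (\<Sum>l\<le>e. y ^ j * (of_nat ((e + i - j) choose l) * y ^ (e + i - j - l) * of_nat ((d + j - i) choose (e - l))))"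
      by (simp add: coeff_mult coeff_linear_power' sum_distrib_left)
    also have "\<dots> = (\<Sum>l\<le>e. of_nat (((e + i - j) choose l) * ((d + j - i) choose (e - l))) * y ^ (i + (e - l)))"
    proof (rule sum.cong)
      fix l assume "l \<in> {..e}"
      show "y ^ j * (of_nat ((e + i - j) choose l) * y ^ (e + i - j - l) * of_nat ((d + j - i) choose (e - l))) =
        of_nat (((e + i - j) choose l) * ((d + j - i) choose (e - l))) * y ^ (i + (e - l))"
      \<comment> \<open>For larger \<open>l\<close> the exponent of \<open>y\<close> truncates, but
        the binomial is 0.\<close>
      proof (cases "l \<le> e + i - j")
        case True
        then have "i + (e - l) = j + (e + i - j - l)" using that \<open>l \<in> _\<close> by auto
        then show ?thesis by (simp add: power_add)
      qed (simp add: binomial_eq_0)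
    qed simp
    also have "\<dots> = (\<Sum>l\<le>e. of_nat (((e + i - j) choose (e - l)) * ((d + j - i) choose l)) * y ^ (i + l))"
      by (rule sum.reindex_bij_witness[of _ "\<lambda>l. e - l" "\<lambda>l. e - l"]) auto
    finally show ?thesis by (simp add: hadamard_term_def poly_sum poly_monom)
  qed
  have "coeff (conv_poly d e h k y) e = (\<Sum>i\<le>d. \<Sum>j\<le>e. of_real (coeff h i) * of_real (coeff k j) *
      (y ^ j * coeff ([:y, 1:] ^ (e + i - j) * [:1, 1:] ^ (d + j - i)) e))"
    by (simp add: conv_poly_def coeff_sum mult.assoc)
  also have "\<dots> = (\<Sum>i\<le>d. \<Sum>j\<le>e. of_real (coeff h i) * of_real (coeff k j) *
      poly (cpoly (hadamard_term d e i j)) y)"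
    by (intro sum.cong) (simp_all only: * atMost_iff)
  finally show ?thesis by (simp add: hadamard_num_def poly_sum)
qed

lemma poly_conv_poly:
  assumes "degree h \<le> d" "degree k \<le> e" "1 + s \<noteq> 0" "y + s \<noteq> 0"
  shows "poly (conv_poly d e h k y) s = (1 + s) ^ d * (y + s) ^ e *
    (poly (cpoly h) ((y + s) / (1 + s)) * poly (cpoly k) (y * (1 + s) / (y + s)))"
proof -
  have *: "y ^ j * ((y + s) ^ (e + i - j) * (1 + s) ^ (d + j - i)) =
    (1 + s) ^ d * (y + s) ^ e * (((y + s) / (1 + s)) ^ i * (y * (1 + s) / (y + s)) ^ j)"
    if "i \<le> d" "j \<le> e" for i j
  proof -
    have "(y + s) ^ (e + i - j) = (y + s) ^ (e + i) / (y + s) ^ j"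
      "(1 + s) ^ (d + j - i) = (1 + s) ^ (d + j) / (1 + s) ^ i"
      using that assms by (simp_all add: power_diff)
    then show ?thesis using assms by (simp add: power_divide power_mult_distrib power_add) (simp only: mult_ac)
  qed
  have lin: "poly [:y, 1:] s = y + s" "poly [:1, 1:] s = 1 + s" by simp_all
  have "poly (conv_poly d e h k y) s = (\<Sum>i\<le>d. \<Sum>j\<le>e. of_real (coeff h i) * of_real (coeff k j) *
      (y ^ j * ((y + s) ^ (e + i - j) * (1 + s) ^ (d + j - i))))"
    unfolding conv_poly_def poly_sum poly_smult poly_mult poly_power lin mult.assoc ..
  also have "\<dots> = (\<Sum>i\<le>d. \<Sum>j\<le>e. of_real (coeff h i) * of_real (coeff k j) *
      ((1 + s) ^ d * (y + s) ^ e * (((y + s) / (1 + s)) ^ i * (y * (1 + s) / (y + s)) ^ j)))"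
    by (intro sum.cong refl arg_cong2[where f = "(*)"] *) auto
  also have "\<dots> = (\<Sum>i\<le>d. \<Sum>j\<le>e. (1 + s) ^ d * (y + s) ^ e *
      ((of_real (coeff h i) * ((y + s) / (1 + s)) ^ i) * (of_real (coeff k j) * (y * (1 + s) / (y + s)) ^ j)))"
    by (intro sum.cong refl) (simp only: mult_ac)
  also have "\<dots> = (1 + s) ^ d * (y + s) ^ e *
    (poly (cpoly h) ((y + s) / (1 + s)) * poly (cpoly k) (y * (1 + s) / (y + s)))"
    unfolding cpoly_altdef[OF assms(1)] cpoly_altdef[OF assms(2)] sum_product by (simp only: sum_distrib_left)
  finally show ?thesis .
qed

text \<open>Each product of linear powers is monic of degree \<open>d + e\<close>, so the top
  coefficient is the plain double sum.\<close>

lemma lead_coeff_conv_poly: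
  assumes "degree h \<le> d" "degree k \<le> e"
  shows "coeff (conv_poly d e h k y) (d + e) = poly (cpoly h) 1 * poly (cpoly k) y"
proof -
  have *: "coeff ([:y, 1:] ^ (e + i - j) * [:1, 1:] ^ (d + j - i)) (d + e) = 1" if "i \<le> d" "j \<le> e" for i j
  proof -
    have "d + e = (e + i - j) + (d + j - i)" using that by auto
    then show ?thesis
      by (simp only: coeff_mult_degree_sum[of "[:y, 1:] ^ (e + i - j)" "[:1, 1:] ^ (d + j - i)",
            unfolded degree_linear_power]) (simp add: coeff_linear_power)
  qed
  have "coeff (conv_poly d e h k y) (d + e) =
    (\<Sum>i\<le>d. \<Sum>j\<le>e. of_real (coeff h i) * of_real (coeff k j) * y ^ j)"
    unfolding conv_poly_def coeff_sum coeff_smult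
    by (intro sum.cong) (simp_all only: * atMost_iff mult_1_right)
  then show ?thesis unfolding cpoly_altdef[OF assms(1)] cpoly_altdef[OF assms(2)]
    by (simp add: sum_product mult.assoc)
qed

text \<open>If \<open>Im ((1 - cnj y) * s) \<ge> 0\<close> then \<open>Y = (y + s) / (1 + s)\<close> lies in the upper half-plane. Hence the
  hypothesis confines all zeros in \<open>s\<close> to an open half-plane with \<open>0\<close> on its boundary, and by
  Gauss--Lucas no coefficient in \<open>s\<close> vanishes.\<close>

lemma hadamard_num_combination_nonzero:
  assumes "Im y > 0"
    and deg: "degree h1 \<le> d" "degree h2 \<le> d" "degree k1 \<le> e" "degree k2 \<le> e"
    and nz: "\<And>Y Z. Im Y > 0 \<Longrightarrow> Y * Z = y \<Longrightarrow>
      c1 * (poly (cpoly h1) Y * poly (cpoly k1) Z) + c2 * (poly (cpoly h2) Y * poly (cpoly k2) Z) \<noteq> 0"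
    and nz1: "c1 * (poly (cpoly h1) 1 * poly (cpoly k1) y) + c2 * (poly (cpoly h2) 1 * poly (cpoly k2) y) \<noteq> 0"
  shows "c1 * poly (cpoly (hadamard_num d e h1 k1)) y + c2 * poly (cpoly (hadamard_num d e h2 k2)) y \<noteq> 0"
proof -
  define K where "K = smult c1 (conv_poly d e h1 k1 y) + smult c2 (conv_poly d e h2 k2 y)"
  \<comment> \<open>The hypothesis at \<open>Y = 1\<close>, \<open>Z = y\<close> concerns the top
    coefficient; it ensures that the index \<open>e\<close> does not exceed the degree.\<close>
  have lead: "coeff K (d + e) \<noteq> 0"
    using nz1 by (simp add: K_def lead_coeff_conv_poly deg)
  then have dK: "K \<noteq> 0" "d + e \<le> degree K" by (auto intro: le_degree)
  have "coeff K e \<noteq> 0"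
  proof (rule coeff_nonzero_of_roots_halfplane)
    fix s assume root: "poly K s = 0"
    show "Im ((1 - cnj y) * s) < 0"
    proof (rule ccontr)
      assume "\<not> Im ((1 - cnj y) * s) < 0"
      \<comment> \<open>This imaginary part equals \<open>Im y + Im ((1 - cnj y) * s)\<close>, and
        it has the sign of \<open>Im Y\<close>.\<close>
      then have im: "Im ((y + s) * cnj (1 + s)) > 0"
        using assms(1) by (simp add: algebra_simps)
      then have n1: "1 + s \<noteq> 0" and n2: "y + s \<noteq> 0" by (metis complex_cnj_zero less_irrefl mult_zero_right zero_complex.sel(2), metis less_irrefl mult_zero_left zero_complex.sel(2))
      define Y where "Y = (y + s) / (1 + s)"
      have "Im Y > 0" unfolding Y_def using im n1
        by (simp only: complex_div_cnj[of "y + s"] Im_divide_of_real) simp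
      moreover have "Y * (y * (1 + s) / (y + s)) = y" using n1 n2 by (simp add: Y_def)
      ultimately have "c1 * (poly (cpoly h1) Y * poly (cpoly k1) (y * (1 + s) / (y + s))) +
        c2 * (poly (cpoly h2) Y * poly (cpoly k2) (y * (1 + s) / (y + s))) \<noteq> 0"
        by (rule nz)
      moreover have "poly K s = (1 + s) ^ d * (y + s) ^ e *
        (c1 * (poly (cpoly h1) Y * poly (cpoly k1) (y * (1 + s) / (y + s))) +
        c2 * (poly (cpoly h2) Y * poly (cpoly k2) (y * (1 + s) / (y + s))))"
        unfolding K_def poly_add poly_smult poly_conv_poly[OF deg(1,3) n1 n2] poly_conv_poly[OF deg(2,4) n1 n2]
          Y_def[symmetric] distrib_left by (simp only: mult_ac)
      ultimately show False using root n1 n2 by simp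
    qed
  qed (use dK in auto)
  then show ?thesis by (simp add: K_def coeff_conv_poly)
qed

section \<open>Interlacing and arguments in the upper half-plane\<close>

text \<open>The argument of \<open>Y - z\<close>, chosen in \<open>(0, \<pi>)\<close>, for \<open>Y\<close> in the upper half-plane.\<close>

definition ang :: "complex \<Rightarrow> real \<Rightarrow> real" where
  "ang Y z = pi / 2 - arctan ((Re Y - z) / Im Y)"

definition angs :: "complex \<Rightarrow> real list \<Rightarrow> real" where
  "angs Y zs = (\<Sum>z\<leftarrow>zs. ang Y z)"

lemma angs_Nil [simp]: "angs Y [] = 0"
  by (simp add: angs_def)

lemma angs_Cons [simp]: "angs Y (z # zs) = ang Y z + angs Y zs"
  by (simp add: angs_def)

lemma ang_bounds: "0 < ang Y z" "ang Y z < pi"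
  using arctan_bounded[of "(Re Y - z) / Im Y"] by (simp_all add: ang_def)

lemma ang_le_iff: "Im Y > 0 \<Longrightarrow> ang Y z \<le> ang Y z' \<longleftrightarrow> z \<le> z'"
  by (simp add: ang_def arctan_le_iff divide_le_cancel)

lemma ang_polar:
  assumes "Im Y > 0"
  shows "Y - of_real z = of_real (cmod (Y - of_real z)) * cis (ang Y z)"
proof -
  define u where "u = (Re Y - z) / Im Y"
  have Y: "Y - of_real z = of_real (Im Y) * Complex u 1"
    using assms by (simp add: complex_eq_iff u_def)
  have n: "cmod (Complex u 1) = sqrt (1 + u\<^sup>2)" by (simp add: cmod_def add.commute)
  have pos: "sqrt (1 + u\<^sup>2) > 0" by (simp add: add_pos_nonneg)
  have "cis (ang Y z) = Complex (u / sqrt (1 + u\<^sup>2)) (1 / sqrt (1 + u\<^sup>2))"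
    by (simp add: ang_def u_def[symmetric] complex_eq_iff cos_diff sin_diff sin_arctan cos_arctan)
  then have "of_real (cmod (Complex u 1)) * cis (ang Y z) = Complex u 1"
    using pos by (simp add: complex_eq_iff n)
  then show ?thesis unfolding Y using assms by (simp add: norm_mult mult.assoc)
qed

lemma prod_linear_polar:
  assumes "Im Y > 0"
  shows "\<exists>\<rho>>0. poly (cpoly (\<Prod>z\<leftarrow>zs. [:-z, 1:])) Y = of_real \<rho> * cis (angs Y zs)"
proof (induction zs)
  case Nil
  show ?case by (auto intro!: exI[of _ 1])
next
  case (Cons z zs)
  then obtain \<rho> where \<rho>: "\<rho> > 0" "poly (cpoly (\<Prod>z\<leftarrow>zs. [:-z, 1:])) Y = of_real \<rho> * cis (angs Y zs)"
    by blast
  have "poly (cpoly [:-z, 1:]) Y = Y - of_real z" by simp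
  then have "poly (cpoly (\<Prod>z\<leftarrow>z # zs. [:-z, 1:])) Y =
      (Y - of_real z) * (of_real \<rho> * cis (angs Y zs))"
    by (simp only: list.map prod_list.Cons cpoly_mult poly_mult \<rho>)
  also have "\<dots> = of_real (cmod (Y - of_real z) * \<rho>) * cis (angs Y (z # zs))"
    by (subst ang_polar[OF assms, of z]) (simp add: cis_mult[symmetric])
  finally have "poly (cpoly (\<Prod>z\<leftarrow>z # zs. [:-z, 1:])) Y =
      of_real (cmod (Y - of_real z) * \<rho>) * cis (angs Y (z # zs))" .
  moreover have "cmod (Y - of_real z) * \<rho> > 0" using assms \<rho> by (auto simp: complex_eq_iff)
  ultimately show ?case by blast
qed

section \<open>Interlacing lists of zeros\<close>

definition interlacing :: "real list \<Rightarrow> real list \<Rightarrow> bool" where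
  "interlacing r s \<longleftrightarrow> (length s = length r \<or> length s = length r + 1) \<and>
     (\<forall>i < length r. r ! i \<le> s ! i) \<and> (\<forall>i < length r. i + 1 < length s \<longrightarrow> s ! (i + 1) \<le> r ! i)"

lemma interlaces_altdef:
  "interlaces b a \<longleftrightarrow> real_rooted a \<and> real_rooted b \<and>
     (a = 0 \<or> b = 0 \<or> interlacing (zeros_desc b) (zeros_desc a))"
  by (simp add: interlaces_def interlacing_def Let_def)

lemma interlacing_Nil [simp]: "interlacing r [] \<longleftrightarrow> r = []"
  by (auto simp: interlacing_def)

text \<open>Removing the largest zero exchanges the roles of the lists; this recursion drives the
  induction on interlacing lists.\<close>

lemma interlacing_Cons:
  "interlacing r (x # s) \<longleftrightarrow> (r \<noteq> [] \<longrightarrow> hd r \<le> x) \<and> interlacing s r"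
proof
  assume *: "interlacing r (x # s)"
  have "hd r \<le> x" if "r \<noteq> []"
    using * that unfolding interlacing_def by (cases r) auto
  moreover have "interlacing s r"
    using * unfolding interlacing_def by (auto simp: nth_Cons')
  ultimately show "(r \<noteq> [] \<longrightarrow> hd r \<le> x) \<and> interlacing s r" by blast
next
  assume *: "(r \<noteq> [] \<longrightarrow> hd r \<le> x) \<and> interlacing s r"
  have "r ! i \<le> (x # s) ! i" if "i < length r" for i
    using * that unfolding interlacing_def by (cases i) (auto simp: hd_conv_nth)
  then show "interlacing r (x # s)"
    using * unfolding interlacing_def by auto
qed

text \<open>As \<open>ang Y\<close> increases with the zero, the difference is an alternating sum of
  weakly decreasing positive terms, hence between 0 and its first term. The equality case serves
  \<open>difference_nonzero\<close>.\<close>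

lemma angs_interlacing:
  assumes "interlacing r s" "Im Y > 0"
  shows "angs Y r \<le> angs Y s \<and> angs Y s - angs Y r \<le> (if s = [] then 0 else ang Y (hd s)) \<and>
    (angs Y s = angs Y r \<longrightarrow> s = r)"
  using assms(1)
proof (induction "length r + length s" arbitrary: r s rule: less_induct)
  case less
  show ?case
  proof (cases s)
    case Nil
    then show ?thesis using less by auto
  next
    case s: (Cons x s')
    have 1: "r \<noteq> [] \<longrightarrow> hd r \<le> x" "interlacing s' r"
      using less.prems by (simp_all add: s interlacing_Cons)
    have IH1: "angs Y s' \<le> angs Y r \<and> angs Y r - angs Y s' \<le> (if r = [] then 0 else ang Y (hd r))"
      using less.hyps[of s' r] 1 s by simp
    show ?thesis
    proof (cases r)
      case Nil
      then show ?thesis using 1 ang_bounds(1)[of Y x] s by (cases s') (auto simp: interlacing_Cons)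
    next
      case r: (Cons y r')
      have 2: "interlacing r' s'" "s' \<noteq> [] \<longrightarrow> hd s' \<le> y" using 1(2) by (simp_all add: r interlacing_Cons)
      have IH2: "angs Y r' \<le> angs Y s' \<and> (angs Y s' = angs Y r' \<longrightarrow> s' = r')"
        using less.hyps[of r' s'] 2 s r by simp
      have yx: "ang Y y \<le> ang Y x" "ang Y x \<le> ang Y y \<Longrightarrow> x = y"
        using 1 r assms(2) by (auto simp: ang_le_iff)
      have "s = r" if "angs Y s = angs Y r"
      proof -
        have "ang Y x + angs Y s' = ang Y y + angs Y r'" using that s r by simp
        then have "ang Y x \<le> ang Y y" "angs Y s' = angs Y r'"
          using IH2 yx by auto
        then show ?thesis using yx(2) IH2 s r by auto
      qed
      then show ?thesis using IH1 IH2 yx r s by auto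
    qed
  qed
qed

section \<open>Real-rooted polynomials: factorization and polar form\<close>

lemma real_rooted_iff:
  assumes "a \<noteq> 0"
  shows "real_rooted a \<longleftrightarrow> (\<forall>Y. Im Y > 0 \<longrightarrow> poly (cpoly a) Y \<noteq> 0)"
proof
  show "real_rooted a \<Longrightarrow> \<forall>Y. Im Y > 0 \<longrightarrow> poly (cpoly a) Y \<noteq> 0"
    using assms by (auto simp: real_rooted_def cpoly_def complex_is_Real_iff)
next
  assume *: "\<forall>Y. Im Y > 0 \<longrightarrow> poly (cpoly a) Y \<noteq> 0"
  have "Im z = 0" if "poly (cpoly a) z = 0" for z
  proof (rule ccontr)
    assume "Im z \<noteq> 0"
    moreover have "poly (cpoly a) (cnj z) = 0" using that by (simp add: cpoly_cnj)
    ultimately show False using * that by (cases "Im z > 0") (auto dest!: spec[of _ "cnj z"])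
  qed
  then show "real_rooted a" by (auto simp: real_rooted_def cpoly_def complex_is_Real_iff)
qed

lemma real_rooted_split:
  assumes "real_rooted a" "a \<noteq> 0"
  shows "\<exists>zs. a = smult (lead_coeff a) (\<Prod>z\<leftarrow>zs. [:-z, 1:])"
  using assms
proof (induction "degree a" arbitrary: a)
  case 0
  then obtain c where "a = [:c:]" by (metis degree_eq_zeroE)
  then show ?case by (intro exI[of _ "[]"]) simp
next
  case (Suc n)
  have "\<not> constant (poly (cpoly a))" using Suc(2) by (simp add: constant_degree)
  then obtain z where z: "poly (cpoly a) z = 0" using fundamental_theorem_of_algebra by blast
  then have "z \<in> \<real>" using Suc.prems by (auto simp: real_rooted_def cpoly_def)
  then obtain x where "z = of_real x" by (auto elim: Reals_cases)
  then have "poly a x = 0" using z by (simp add: cpoly_of_real)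
  then obtain b where b: "a = [:-x, 1:] * b" by (metis dvdE poly_eq_0_iff_dvd)
  have "b \<noteq> 0" using b Suc.prems by auto
  have "degree b = n" using Suc(2) \<open>b \<noteq> 0\<close> unfolding b by (subst (asm) degree_mult_eq) auto
  moreover have "real_rooted b"
    using Suc.prems(1) \<open>b \<noteq> 0\<close> b Suc.prems(2) by (auto simp: real_rooted_iff simp del: mult_pCons_left)
  ultimately obtain zs where "b = smult (lead_coeff b) (\<Prod>z\<leftarrow>zs. [:-z, 1:])"
    using Suc.hyps(1) \<open>b \<noteq> 0\<close> by blast
  moreover have "lead_coeff a = lead_coeff b" by (simp only: b lead_coeff_mult) simp
  ultimately have "a = smult (lead_coeff a) (\<Prod>z\<leftarrow>x # zs. [:-z, 1:])"
    by (metis (no_types, lifting) b list.map(2) mult_smult_right prod_list.Cons)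
  then show ?case by blast
qed

lemma proots_prod_linear:
  assumes "c \<noteq> (0 :: real)"
  shows "proots (smult c (\<Prod>z\<leftarrow>zs. [:-z, 1:])) = mset zs"
proof -
  have "(\<Prod>z\<leftarrow>zs. [:-z, 1:]) \<noteq> 0 \<and> proots (\<Prod>z\<leftarrow>zs. [:-z, 1:]) = mset zs"
  proof (induction zs)
    case (Cons z zs)
    then show ?case using proots_mult[of "[:-z, 1:]" "\<Prod>z\<leftarrow>zs. [:-z, 1:]"]
      by (simp del: mult_pCons_left)
  qed simp
  then show ?thesis using assms by simp
qed

lemma sorted_zeros_desc: "sorted_wrt (\<ge>) (zeros_desc a)"
  unfolding zeros_desc_def sorted_wrt_rev using sorted_sorted_list_of_multiset by simp

lemma zeros_desc_prod_linear:
  assumes "c \<noteq> 0" "sorted_wrt (\<ge>) zs"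
  shows "zeros_desc (smult c (\<Prod>z\<leftarrow>zs. [:-z, 1:])) = zs"
proof -
  have "sorted (rev zs)" using assms(2) by (simp add: sorted_wrt_rev)
  then have "sort zs = rev zs"
    by (intro properties_for_sort) simp_all
  then show ?thesis unfolding zeros_desc_def proots_prod_linear[OF assms(1)] by simp
qed

lemma real_rooted_factor:
  assumes "real_rooted a" "a \<noteq> 0"
  shows "smult (lead_coeff a) (\<Prod>z\<leftarrow>zeros_desc a. [:-z, 1:]) = a"
proof -
  obtain zs where zs: "a = smult (lead_coeff a) (\<Prod>z\<leftarrow>zs. [:-z, 1:])"
    using real_rooted_split[OF assms] by blast
  have "proots a = mset zs"
    using proots_prod_linear[of "lead_coeff a" zs] assms by (simp flip: zs)
  then have "mset (zeros_desc a) = mset zs" by (simp add: zeros_desc_def)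
  then have "(\<Prod>z\<leftarrow>zeros_desc a. [:-z, 1:]) = (\<Prod>z\<leftarrow>zs. [:-z, 1:])"
    by (metis mset_map prod_mset_prod_list)
  then show ?thesis using zs by simp
qed

lemma set_zeros_desc: "a \<noteq> 0 \<Longrightarrow> set (zeros_desc a) = {x. poly a x = 0}"
  by (simp add: zeros_desc_def)

lemma real_rooted_polar:
  assumes "real_rooted a" "lead_coeff a > 0" "Im Y > 0"
  shows "\<exists>\<rho>>0. poly (cpoly a) Y = of_real \<rho> * cis (angs Y (zeros_desc a))"
proof -
  have "a \<noteq> 0" using assms(2) by auto
  obtain \<rho> where \<rho>: "\<rho> > 0"
    "poly (cpoly (\<Prod>z\<leftarrow>zeros_desc a. [:-z, 1:])) Y = of_real \<rho> * cis (angs Y (zeros_desc a))"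
    using prod_linear_polar[OF assms(3)] by blast
  have "poly (cpoly a) Y = of_real (lead_coeff a * \<rho>) * cis (angs Y (zeros_desc a))"
    by (subst real_rooted_factor[OF assms(1) \<open>a \<noteq> 0\<close>, symmetric])
      (simp only: cpoly_smult poly_smult \<rho> of_real_mult mult.assoc)
  then show ?thesis using \<rho>(1) assms(2) by (intro exI[of _ "lead_coeff a * \<rho>"]) simp
qed

lemma Im_mult_cnj_polar:
  "Im ((of_real x * cis s) * cnj (of_real y * cis t)) = x * y * sin (s - t)"
  by (simp add: sin_diff algebra_simps)

text \<open>The direct half of Hermite--Biehler: the difference of the arguments lies between 0 and
  a single angle below \<pi>, where the sine is nonnegative.\<close>

lemma interlacing_imp_Im_nonneg:
  assumes "real_rooted a" "lead_coeff a > 0" "real_rooted b" "lead_coeff b > 0"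
    and "interlacing (zeros_desc b) (zeros_desc a)" "Im Y > 0"
  shows "Im (poly (cpoly a) Y * cnj (poly (cpoly b) Y)) \<ge> 0"
proof -
  obtain \<rho> where \<rho>: "\<rho> > 0" "poly (cpoly a) Y = of_real \<rho> * cis (angs Y (zeros_desc a))"
    using real_rooted_polar assms by blast
  obtain \<sigma> where \<sigma>: "\<sigma> > 0" "poly (cpoly b) Y = of_real \<sigma> * cis (angs Y (zeros_desc b))"
    using real_rooted_polar assms by blast
  have "0 \<le> angs Y (zeros_desc a) - angs Y (zeros_desc b)"
    "angs Y (zeros_desc a) - angs Y (zeros_desc b) \<le> pi"
    using angs_interlacing[OF assms(5,6)] ang_bounds(2)[of Y "hd (zeros_desc a)"]
    by (auto split: if_splits)
  then have "sin (angs Y (zeros_desc a) - angs Y (zeros_desc b)) \<ge> 0" by (rule sin_ge_zero)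
  then show ?thesis unfolding \<rho>(2) \<sigma>(2) Im_mult_cnj_polar using \<rho>(1) \<sigma>(1) by simp
qed

section \<open>Continuity of the argument difference\<close>

lemma continuous_on_angs: "continuous_on {Y. Im Y > 0} (\<lambda>Y. angs Y zs)"
proof (induction zs)
  case (Cons z zs)
  have "continuous_on {Y. Im Y > 0} (\<lambda>Y. ang Y z)"
    unfolding ang_def by (intro continuous_intros) simp
  then show ?case using Cons by (simp add: continuous_on_add)
qed simp

lemma connected_upper_halfplane: "connected {Y. Im Y > 0}"
  by (intro convex_connected convex_halfspace_Im_gt)

lemma upper_halfplane_IVT:
  fixes g :: "complex \<Rightarrow> real"
  assumes "continuous_on {Y. Im Y > 0} g" "Im Y0 > 0" "Im Y1 > 0" "g Y0 \<le> c" "c \<le> g Y1"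
  shows "\<exists>Y. Im Y > 0 \<and> g Y = c"
proof -
  have "connected (g ` {Y. Im Y > 0})"
    by (intro connected_continuous_image assms connected_upper_halfplane)
  then have "c \<in> g ` {Y. Im Y > 0}"
    using assms connected_contains_Icc[of "g ` {Y. Im Y > 0}" "g Y0" "g Y1"] by auto
  then show ?thesis by auto
qed

text \<open>Far to the right all arguments tend to 0, which provides base points for the continuity
  arguments.\<close>

lemma angs_at_top: "((\<lambda>t. angs (Complex t 1) zs) \<longlongrightarrow> 0) at_top"
proof (induction zs)
  case (Cons z zs)
  have "((\<lambda>t. pi / 2 - arctan (t - z)) \<longlongrightarrow> pi / 2 - pi / 2) at_top"
    by (intro tendsto_intros filterlim_compose[OF tendsto_arctan_at_top])
      (rule filterlim_tendsto_add_at_top[OF tendsto_const[of "- z"] filterlim_ident, simplified])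
  then have "((\<lambda>t. ang (Complex t 1) z) \<longlongrightarrow> 0) at_top" by (simp add: ang_def)
  from tendsto_add[OF this Cons] show ?case by simp
qed simp

lemma ex_angs_small:
  assumes "\<eta> > 0"
  shows "\<exists>Y. Im Y > 0 \<and> \<bar>angs Y s - angs Y r\<bar> < \<eta>"
proof -
  have "((\<lambda>t. angs (Complex t 1) s - angs (Complex t 1) r) \<longlongrightarrow> 0 - 0) at_top"
    by (intro tendsto_diff angs_at_top)
  then have "\<forall>\<^sub>F t in at_top. dist (angs (Complex t 1) s - angs (Complex t 1) r) 0 < \<eta>"
    using assms by (simp add: tendsto_iff)
  then obtain t where "dist (angs (Complex t 1) s - angs (Complex t 1) r) 0 < \<eta>"
    using eventually_happens by force
  then show ?thesis by (intro exI[of _ "Complex t 1"]) simp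
qed

text \<open>A nonnegative sine confines the difference to intervals from an even multiple of \<pi>
  to the next odd one; connectedness and a point where the difference is small select the interval
  from 0 to \<pi>.\<close>

lemma angs_diff_bounds:
  assumes "\<And>Y. Im Y > 0 \<Longrightarrow> sin (angs Y s - angs Y r) \<ge> 0" "Im Y > 0"
  shows "0 \<le> angs Y s - angs Y r" "angs Y s - angs Y r \<le> pi"
proof -
  define g where "g Y = angs Y s - angs Y r" for Y
  have cont: "continuous_on {Y. Im Y > 0} g"
    unfolding g_def by (intro continuous_intros continuous_on_angs)
  obtain Y0 where Y0: "Im Y0 > 0" "\<bar>g Y0\<bar> < pi / 2"
    using ex_angs_small[of "pi / 2" s r] by (auto simp: g_def)
  have g0: "g Y0 \<ge> 0"
  proof (rule ccontr)
    assume "\<not> 0 \<le> g Y0"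
    then have "sin (g Y0) < 0" using Y0 sin_gt_zero[of "- g Y0"] by simp
    then show False using assms(1)[OF Y0(1)] by (simp add: g_def)
  qed
  show "0 \<le> angs Y s - angs Y r"
  proof (rule ccontr)
    assume "\<not> 0 \<le> angs Y s - angs Y r"
    then have neg: "g Y < 0" by (simp add: g_def)
    \<comment> \<open>Clipping at \<open>- pi / 2\<close> yields an attained value strictly between
      -\<pi> and 0.\<close>
    have "g Y \<le> max (g Y) (- pi / 2)" "max (g Y) (- pi / 2) \<le> g Y0" using g0 neg pi_gt_zero by linarith+
    then obtain Z where Z: "Im Z > 0" "g Z = max (g Y) (- pi / 2)"
      using upper_halfplane_IVT[OF cont assms(2) Y0(1)] by blast
    have "0 < - g Z" "- g Z < pi" using Z(2) neg pi_gt_zero by linarith+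
    then have "sin (g Z) < 0" using sin_gt_zero[of "- g Z"] by simp
    then show False using assms(1)[OF Z(1)] by (simp add: g_def)
  qed
  show "angs Y s - angs Y r \<le> pi"
  proof (rule ccontr)
    assume "\<not> angs Y s - angs Y r \<le> pi"
    then have gt: "g Y > pi" by (simp add: g_def)
    \<comment> \<open>Clipping at \<open>3 * pi / 2\<close> yields an attained value strictly
      between \<pi> and 2\<pi>.\<close>
    have "g Y0 \<le> min (g Y) (3 * pi / 2)" "min (g Y) (3 * pi / 2) \<le> g Y" using Y0(2) gt pi_gt_zero by linarith+
    then obtain Z where Z: "Im Z > 0" "g Z = min (g Y) (3 * pi / 2)"
      using upper_halfplane_IVT[OF cont Y0(1) assms(2)] by blast
    have "pi < g Z" "g Z < 2 * pi" using Z(2) gt pi_gt_zero by linarith+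
    then have "sin (g Z) < 0" by (rule sin_lt_zero)
    then show False using assms(1)[OF Z(1)] by (simp add: g_def)
  qed
qed

section \<open>Counting zeros by boundary values of arguments\<close>

text \<open>In the limit each zero larger than \<open>t\<close> contributes \<pi> and each smaller
  one 0. A zero at \<open>t\<close> itself would contribute \<pi>/2.\<close>

lemma angs_at_right_0:
  assumes "t \<notin> set zs"
  shows "((\<lambda>\<epsilon>. angs (Complex t \<epsilon>) zs) \<longlongrightarrow> pi * length (filter (\<lambda>z. t < z) zs)) (at_right 0)"
  using assms
proof (induction zs)
  case (Cons z zs)
  have inv: "filterlim (\<lambda>\<epsilon>::real. inverse \<epsilon>) at_top (at_right 0)"
    by (rule filterlim_inverse_at_top_right)
  have "((\<lambda>\<epsilon>. ang (Complex t \<epsilon>) z) \<longlongrightarrow> (if t < z then pi else 0)) (at_right 0)"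
  proof (cases "t < z")
    case True
    have "filterlim (\<lambda>\<epsilon>. (t - z) / \<epsilon>) at_bot (at_right 0)"
      using True unfolding divide_inverse by (intro filterlim_tendsto_neg_mult_at_bot[OF tendsto_const _ inv]) auto
    then have "((\<lambda>\<epsilon>. pi / 2 - arctan ((t - z) / \<epsilon>)) \<longlongrightarrow> pi / 2 - (- (pi / 2))) (at_right 0)"
      by (intro tendsto_intros filterlim_compose[OF tendsto_arctan_at_bot])
    then show ?thesis using True by (simp add: ang_def)
  next
    case False
    then have "t - z > 0" using Cons.prems by auto
    then have "filterlim (\<lambda>\<epsilon>. (t - z) / \<epsilon>) at_top (at_right 0)"
      unfolding divide_inverse by (intro filterlim_tendsto_pos_mult_at_top[OF tendsto_const _ inv]) auto
    then have "((\<lambda>\<epsilon>. pi / 2 - arctan ((t - z) / \<epsilon>)) \<longlongrightarrow> pi / 2 - pi / 2) (at_right 0)"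
      by (intro tendsto_intros filterlim_compose[OF tendsto_arctan_at_top])
    then show ?thesis using False by (simp add: ang_def)
  qed
  moreover have "((\<lambda>\<epsilon>. angs (Complex t \<epsilon>) zs) \<longlongrightarrow> pi * length (filter (\<lambda>z. t < z) zs)) (at_right 0)"
    using Cons by simp
  ultimately have "((\<lambda>\<epsilon>. ang (Complex t \<epsilon>) z + angs (Complex t \<epsilon>) zs) \<longlongrightarrow>
      (if t < z then pi else 0) + pi * length (filter (\<lambda>z. t < z) zs)) (at_right 0)"
    by (rule tendsto_add)
  moreover have "(if t < z then pi else 0) + pi * length (filter (\<lambda>z. t < z) zs) =
      pi * length (filter (\<lambda>z. t < z) (z # zs))"
    by (simp add: algebra_simps)
  ultimately show ?case by simp
qed simp

lemma count_bounds:
  assumes "\<And>Y. Im Y > 0 \<Longrightarrow> 0 \<le> angs Y s - angs Y r \<and> angs Y s - angs Y r \<le> pi"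
  shows "length (filter (\<lambda>z. t < z) r) \<le> length (filter (\<lambda>z. t < z) s) \<and>
    length (filter (\<lambda>z. t < z) s) \<le> length (filter (\<lambda>z. t < z) r) + 1"
proof -
  define A where "A = set s \<union> set r"
  \<comment> \<open>The limit formula excludes zeros, so \<open>t\<close> is moved right to a
    non-zero \<open>u\<close> with the same counts.\<close>
  obtain u where u: "t < u" "\<And>z. z \<in> A \<Longrightarrow> t < z \<longleftrightarrow> u < z" "u \<notin> A"
  proof (cases "{z \<in> A. t < z} = {}")
    case True
    then show ?thesis using that[of "t + 1"] by fastforce
  next
    case False
    define m where "m = Min {z \<in> A. t < z}"
    have fin: "finite {z \<in> A. t < z}" by (simp add: A_def)
    have m: "m \<in> A" "t < m" using Min_in[OF fin False] by (auto simp: m_def)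
    have "m \<le> z" if "z \<in> A" "t < z" for z using that fin by (simp add: m_def)
    then show ?thesis using m that[of "(t + m) / 2"] by force
  qed
  let ?n = "\<lambda>zs. length (filter (\<lambda>z. u < z) zs)"
  have lim: "((\<lambda>\<epsilon>. angs (Complex u \<epsilon>) s - angs (Complex u \<epsilon>) r) \<longlongrightarrow> pi * ?n s - pi * ?n r) (at_right 0)"
    using u(3) by (intro tendsto_diff angs_at_right_0) (auto simp: A_def)
  have ev: "\<forall>\<^sub>F \<epsilon> in at_right (0::real). \<epsilon> > 0" by (rule eventually_at_right_less)
  have "0 \<le> pi * ?n s - pi * ?n r"
    by (rule tendsto_lowerbound[OF lim])
      (use ev assms in \<open>auto elim!: eventually_mono\<close>)
  moreover have "pi * ?n s - pi * ?n r \<le> pi"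
    by (rule tendsto_upperbound[OF lim])
      (use ev assms in \<open>auto elim!: eventually_mono\<close>)
  ultimately have "0 \<le> pi * (real (?n s) - real (?n r))" "pi * (real (?n s) - real (?n r)) \<le> pi * 1"
    by (simp_all add: algebra_simps)
  then have "real (?n r) \<le> real (?n s)" "real (?n s) \<le> real (?n r) + 1"
    using pi_gt_zero by (simp_all add: zero_le_mult_iff)
  then have "?n r \<le> ?n s" "?n s \<le> ?n r + 1"
    by linarith+
  moreover have "filter (\<lambda>z. t < z) s = filter (\<lambda>z. u < z) s" "filter (\<lambda>z. t < z) r = filter (\<lambda>z. u < z) r"
    using u(2) by (auto simp: A_def intro!: filter_cong)
  ultimately show ?thesis by simp
qed

text \<open>In a descending list the entries above \<open>t\<close> form an initial segment.\<close>

lemma nth_greater_iff: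
  fixes s :: "real list"
  assumes "sorted_wrt (\<ge>) s" "i < length s"
  shows "t < s ! i \<longleftrightarrow> i < length (filter (\<lambda>z. t < z) s)"
  using assms
proof (induction s arbitrary: i)
  case (Cons x s)
  show ?case
  proof (cases "t < x")
    case True
    then show ?thesis using Cons by (cases i) auto
  next
    case False
    then have "\<forall>z\<in>set (x # s). \<not> t < z" using Cons.prems by auto
    then have "filter (\<lambda>z. t < z) (x # s) = []" "\<not> t < (x # s) ! i"
      using Cons.prems(2) nth_mem by (blast intro: filter_False)+
    then show ?thesis by simp
  qed
qed simp

text \<open>A violated inequality shows up in the counts when the smaller of its two entries is
  taken as threshold.\<close>

lemma interlacing_of_counts:
  fixes r s :: "real list"
  assumes "sorted_wrt (\<ge>) r" "sorted_wrt (\<ge>) s"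
    and count: "\<And>t. length (filter (\<lambda>z. t < z) r) \<le> length (filter (\<lambda>z. t < z) s) \<and>
      length (filter (\<lambda>z. t < z) s) \<le> length (filter (\<lambda>z. t < z) r) + 1"
  shows "interlacing r s"
proof -
  \<comment> \<open>A threshold below all entries counts everything and gives the length
    condition.\<close>
  define t where "t = Min (insert 0 (set r \<union> set s)) - 1"
  have "t < z" if "z \<in> set r \<union> set s" for z
  proof -
    have "Min (insert 0 (set r \<union> set s)) \<le> z" using that by (intro Min_le) auto
    then show ?thesis by (simp add: t_def)
  qed
  then have "filter (\<lambda>z. t < z) r = r" "filter (\<lambda>z. t < z) s = s" by auto
  then have len: "length s = length r \<or> length s = length r + 1" using count[of t] by simp linarith
  moreover have "r ! i \<le> s ! i" if i: "i < length r" for i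
  proof (rule ccontr)
    assume "\<not> r ! i \<le> s ! i"
    then have "i < length (filter (\<lambda>z. s ! i < z) r)" using nth_greater_iff[OF assms(1) i, of "s ! i"] by simp
    moreover have "\<not> i < length (filter (\<lambda>z. s ! i < z) s)"
      using nth_greater_iff[OF assms(2), of i "s ! i"] i len by auto
    ultimately show False using count[of "s ! i"] by linarith
  qed
  moreover have "s ! (i + 1) \<le> r ! i" if i: "i < length r" "i + 1 < length s" for i
  proof (rule ccontr)
    assume "\<not> s ! (i + 1) \<le> r ! i"
    then have "i + 1 < length (filter (\<lambda>z. r ! i < z) s)" using nth_greater_iff[OF assms(2) i(2), of "r ! i"] by simp
    moreover have "\<not> i < length (filter (\<lambda>z. r ! i < z) r)"
      using nth_greater_iff[OF assms(1) i(1), of "r ! i"] by simp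
    ultimately show False using count[of "r ! i"] by linarith
  qed
  ultimately show ?thesis unfolding interlacing_def by blast
qed

text \<open>The converse half of a Hermite--Biehler theorem: as \<open>Y\<close> tends to a real \<open>t\<close>, the difference of the
  arguments tends to \<open>\<pi>\<close> times the difference of the numbers of zeros larger than \<open>t\<close>.\<close>

lemma Im_nonneg_imp_interlacing:
  assumes "real_rooted a" "lead_coeff a > 0" "real_rooted b" "lead_coeff b > 0"
    and "\<And>Y. Im Y > 0 \<Longrightarrow> Im (poly (cpoly a) Y * cnj (poly (cpoly b) Y)) \<ge> 0"
  shows "interlacing (zeros_desc b) (zeros_desc a)"
proof -
  have "sin (angs Y (zeros_desc a) - angs Y (zeros_desc b)) \<ge> 0" if Y: "Im Y > 0" for Y
  proof -
    obtain \<rho> where \<rho>: "\<rho> > 0" "poly (cpoly a) Y = of_real \<rho> * cis (angs Y (zeros_desc a))"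
      using real_rooted_polar assms Y by blast
    obtain \<sigma> where \<sigma>: "\<sigma> > 0" "poly (cpoly b) Y = of_real \<sigma> * cis (angs Y (zeros_desc b))"
      using real_rooted_polar assms Y by blast
    show ?thesis using assms(5)[OF Y] \<rho>(1) \<sigma>(1) unfolding \<rho>(2) \<sigma>(2) Im_mult_cnj_polar
      by (simp add: zero_le_mult_iff mult_le_0_iff)
  qed
  then show ?thesis
    by (intro interlacing_of_counts sorted_zeros_desc count_bounds conjI angs_diff_bounds) auto
qed

section \<open>Symmetric decompositions\<close>

lemma nonneg_coeffs_lead_pos: "nonneg_coeffs a \<Longrightarrow> a \<noteq> 0 \<Longrightarrow> lead_coeff a > 0"
  unfolding nonneg_coeffs_def by (metis leading_coeff_0_iff order_le_less)

lemma nonneg_coeffs_poly_pos: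
  assumes "nonneg_coeffs a" "a \<noteq> 0" "x > 0"
  shows "poly a x > 0"
proof -
  have "0 < lead_coeff a * x ^ degree a"
    using nonneg_coeffs_lead_pos[OF assms(1,2)] assms(3) by simp
  also have "\<dots> \<le> (\<Sum>i\<le>degree a. coeff a i * x ^ i)"
    using assms by (intro member_le_sum) (auto simp: nonneg_coeffs_def)
  finally show ?thesis by (simp add: poly_altdef)
qed

lemma nonneg_coeffs_add: "nonneg_coeffs a \<Longrightarrow> nonneg_coeffs b \<Longrightarrow> nonneg_coeffs (a + b)"
  by (simp add: nonneg_coeffs_def)

lemma nonneg_coeffs_mult: "nonneg_coeffs a \<Longrightarrow> nonneg_coeffs b \<Longrightarrow> nonneg_coeffs (a * b)"
  by (auto simp: nonneg_coeffs_def coeff_mult intro!: sum_nonneg)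

lemma nonneg_coeffs_recip_poly: "nonneg_coeffs a \<Longrightarrow> nonneg_coeffs (recip_poly d a)"
  by (simp add: nonneg_coeffs_def coeff_recip_poly)

lemma nonneg_coeffs_linear: "z \<le> 0 \<Longrightarrow> nonneg_coeffs [:-z, 1:]"
  by (auto simp: nonneg_coeffs_def coeff_pCons split: nat.split)

lemma nonneg_coeffs_prod_linear:
  "\<forall>z\<in>set zs. z \<le> 0 \<Longrightarrow> nonneg_coeffs (\<Prod>z\<leftarrow>zs. [:-z, 1:])"
proof (induction zs)
  case Nil
  then show ?case by (simp add: nonneg_coeffs_def)
next
  case (Cons z zs)
  then show ?case using nonneg_coeffs_mult[OF nonneg_coeffs_linear[of z]]
    by (simp del: mult_pCons_left)
qed

lemma zeros_desc_nonpos: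
  assumes "nonneg_coeffs a" "a \<noteq> 0" "z \<in> set (zeros_desc a)"
  shows "z \<le> 0"
proof -
  have "poly a z = 0" using set_zeros_desc[OF assms(2)] assms(3) by auto
  then show ?thesis using nonneg_coeffs_poly_pos[OF assms(1,2), of z] by force
qed

lemma real_rooted_mult:
  "a \<noteq> 0 \<Longrightarrow> b \<noteq> 0 \<Longrightarrow> real_rooted a \<Longrightarrow> real_rooted b \<Longrightarrow> real_rooted (a * b)"
  by (simp add: real_rooted_iff)

lemma real_rooted_X: "real_rooted [:0, 1:]"
  by (subst real_rooted_iff) auto

lemma zeros_desc_X_mult:
  assumes "real_rooted a" "a \<noteq> 0" "\<forall>z\<in>set (zeros_desc a). z \<le> 0"
  shows "zeros_desc ([:0, 1:] * a) = 0 # zeros_desc a"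
proof -
  have "[:0, 1:] * a = smult (lead_coeff a) (\<Prod>z\<leftarrow>0 # zeros_desc a. [:-z, 1:])"
    by (subst real_rooted_factor[OF assms(1,2), symmetric]) simp
  moreover have "sorted_wrt (\<ge>) (0 # zeros_desc a)" using assms(3) sorted_zeros_desc[of a] by simp
  ultimately show ?thesis using zeros_desc_prod_linear[of "lead_coeff a" "0 # zeros_desc a"] assms(2)
    by (simp del: mult_pCons_left)
qed

section \<open>The cone condition\<close>

text \<open>Off the nonpositive real axis, \<open>h(Y) / g(Y)\<close> lies in the convex cone spanned by \<open>1\<close> and \<open>Y\<close>.\<close>

definition sector_related :: "real poly \<Rightarrow> real poly \<Rightarrow> bool" where
  "sector_related h g \<longleftrightarrow> (\<forall>Y. Y \<notin> \<real>\<^sub>\<le>\<^sub>0 \<longrightarrow> poly (cpoly g) Y \<noteq> 0 \<and>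
    (\<exists>\<alpha> \<beta>. 0 \<le> \<alpha> \<and> 0 \<le> \<beta> \<and> 0 < \<alpha> + \<beta> \<and>
      poly (cpoly h) Y = (of_real \<alpha> + of_real \<beta> * Y) * poly (cpoly g) Y))"

lemma Im_of_real_mult: "Im (of_real r * z) = r * Im z"
  by simp

text \<open>The two sign conditions place the argument of \<open>N / D\<close> between 0 and that of
  \<open>Y\<close>; \<alpha> and \<beta> are its real coordinates in the basis 1,
  \<open>Y\<close>.\<close>

lemma cone_representation:
  assumes "Im Y > 0" "N \<noteq> 0" "D \<noteq> 0" "Im (N * cnj D) \<ge> 0" "Im (Y * D * cnj N) \<ge> 0"
  shows "\<exists>\<alpha> \<beta>. 0 \<le> \<alpha> \<and> 0 \<le> \<beta> \<and> 0 < \<alpha> + \<beta> \<and> N = (of_real \<alpha> + of_real \<beta> * Y) * D"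
proof -
  define \<rho> where "\<rho> = N / D"
  have N: "N = \<rho> * D" using assms by (simp add: \<rho>_def)
  have D: "D * cnj D = of_real ((cmod D)\<^sup>2)" by (rule complex_norm_square[symmetric])
  have pos: "(cmod D)\<^sup>2 > 0" using assms by simp
  have "N * cnj D = of_real ((cmod D)\<^sup>2) * \<rho>" unfolding N by (simp only: D[symmetric] mult_ac)
  then have 1: "Im \<rho> \<ge> 0" using assms(4) pos by (simp only: Im_of_real_mult zero_le_mult_iff) auto
  have "Y * D * cnj N = of_real ((cmod D)\<^sup>2) * (Y * cnj \<rho>)"
    unfolding N complex_cnj_mult by (simp only: D[symmetric] mult_ac)
  then have 2: "Im (Y * cnj \<rho>) \<ge> 0" using assms(5) pos
    by (simp only: Im_of_real_mult zero_le_mult_iff) auto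
  define \<beta> where "\<beta> = Im \<rho> / Im Y"
  define \<alpha> where "\<alpha> = Re \<rho> - \<beta> * Re Y"
  have "\<alpha> * Im Y = Im (Y * cnj \<rho>)" using assms(1) by (simp add: \<alpha>_def \<beta>_def field_simps)
  then have "\<alpha> \<ge> 0" using 2 assms(1) by (metis zero_le_mult_iff not_less)
  moreover have "\<beta> \<ge> 0" using 1 assms(1) by (simp add: \<beta>_def)
  moreover have rep: "\<rho> = of_real \<alpha> + of_real \<beta> * Y" using assms(1) by (simp add: complex_eq_iff \<alpha>_def \<beta>_def)
  moreover have "\<rho> \<noteq> 0" using N assms by auto
  ultimately have "0 < \<alpha> + \<beta>" by (cases "\<alpha> = 0"; cases "\<beta> = 0") auto
  then show ?thesis using \<open>\<alpha> \<ge> 0\<close> \<open>\<beta> \<ge> 0\<close> rep N by blast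
qed

lemma sector_related_upper:
  assumes "nonneg_coeffs a" "nonneg_coeffs b" "interlaces b a" "a + b \<noteq> 0" "Im Y > 0"
  defines "h \<equiv> a + [:0, 1:] * b"
  shows "poly (cpoly (a + b)) Y \<noteq> 0 \<and>
    (\<exists>\<alpha> \<beta>. 0 \<le> \<alpha> \<and> 0 \<le> \<beta> \<and> 0 < \<alpha> + \<beta> \<and>
      poly (cpoly h) Y = (of_real \<alpha> + of_real \<beta> * Y) * poly (cpoly (a + b)) Y)"
proof -
  have rr: "real_rooted a" "real_rooted b" using assms(3) by (simp_all add: interlaces_def)
  consider "b = 0" "a \<noteq> 0" | "a = 0" "b \<noteq> 0" | "a \<noteq> 0" "b \<noteq> 0" using assms(4) by auto
  then show ?thesis
  proof cases
    case 1
    then have nz: "poly (cpoly (a + b)) Y \<noteq> 0" using rr(1) assms(5) by (simp add: real_rooted_iff)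
    show ?thesis by (rule conjI[OF nz], rule exI[of _ "1 :: real"], rule exI[of _ "0 :: real"]) (simp add: h_def 1)
  next
    case 2
    then have nz: "poly (cpoly (a + b)) Y \<noteq> 0" using rr(2) assms(5) by (simp add: real_rooted_iff)
    show ?thesis by (rule conjI[OF nz], rule exI[of _ "0 :: real"], rule exI[of _ "1 :: real"]) (simp add: h_def 2)
  next
    case 3
    define A where "A = poly (cpoly a) Y"
    define B where "B = poly (cpoly b) Y"
    have lead: "lead_coeff a > 0" "lead_coeff b > 0" using 3 assms nonneg_coeffs_lead_pos by auto
    have il: "interlacing (zeros_desc b) (zeros_desc a)" using 3 assms(3) by (simp add: interlaces_altdef)
    have AB: "Im (A * cnj B) \<ge> 0"
      unfolding A_def B_def using rr lead il assms(5) by (intro interlacing_imp_Im_nonneg)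
    have np: "\<forall>z\<in>set (zeros_desc a). z \<le> 0" "\<forall>z\<in>set (zeros_desc b). z \<le> 0"
      using zeros_desc_nonpos assms 3 by blast+
    \<comment> \<open>No zero is positive, so the new zero 0 comes first, and \<open>b\<close>
      interlacing \<open>a\<close> turns into \<open>a\<close> interlacing
      \<open>x b\<close>.\<close>
    have "interlacing (zeros_desc a) (zeros_desc ([:0, 1:] * b))"
      using zeros_desc_X_mult[OF rr(2) 3(2) np(2)] il np(1) by (simp add: interlacing_Cons)
    moreover have "lead_coeff ([:0, 1:] * b) > 0" using lead by (subst lead_coeff_mult) simp
    moreover have "real_rooted ([:0, 1:] * b)" using rr 3 by (intro real_rooted_mult real_rooted_X) auto
    ultimately have "Im (poly (cpoly ([:0, 1:] * b)) Y * cnj (poly (cpoly a) Y)) \<ge> 0"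
      using rr lead assms(5) by (intro interlacing_imp_Im_nonneg)
    then have BA: "Im (Y * B * cnj A) \<ge> 0" by (simp add: A_def B_def)
    have nz: "A \<noteq> 0" "B \<noteq> 0" using rr 3 assms(5) by (auto simp: real_rooted_iff A_def B_def)
    have sq: "Im (Y * (z * cnj z)) = Im Y * (cmod z)\<^sup>2" "Im ((Y * cnj Y) * z) = (cmod Y)\<^sup>2 * Im z" for z
      unfolding cmod_power2 by (simp_all add: algebra_simps power2_eq_square)
    \<comment> \<open>The last term, \<open>Im Y\<close> times the squared modulus of
      \<open>B\<close>, makes this strictly positive; hence both factors are nonzero.\<close>
    have "Im ((A + Y * B) * cnj (A + B)) = Im (A * cnj B) + Im (Y * B * cnj A) + Im (Y * (B * cnj B))"
      by (simp add: algebra_simps)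
    also have "\<dots> > 0" using AB BA nz assms(5) unfolding sq by (intro add_nonneg_pos) auto
    finally have 1: "Im ((A + Y * B) * cnj (A + B)) > 0" .
    have "Im (Y * (A + B) * cnj (A + Y * B)) =
        Im (Y * (A * cnj A)) + Im ((Y * cnj Y) * (A * cnj B)) + Im (Y * B * cnj A)"
      by (simp add: algebra_simps)
    also have "\<dots> \<ge> 0" using AB BA assms(5) unfolding sq by (intro add_nonneg_nonneg) auto
    finally have 2: "Im (Y * (A + B) * cnj (A + Y * B)) \<ge> 0" .
    have nz': "A + Y * B \<noteq> 0" "A + B \<noteq> 0"
      using 1 by (metis less_irrefl mult_zero_left zero_complex.sel(2), metis complex_cnj_zero less_irrefl mult_zero_right zero_complex.sel(2))
    show ?thesis
      using cone_representation[OF assms(5) nz' less_imp_le[OF 1] 2] nz' by (simp add: h_def A_def B_def)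
  qed
qed

text \<open>Conjugation reduces the lower half-plane to the upper one; on the positive axis both
  polynomials are positive.\<close>

lemma sector_related_decomposition:
  assumes "nonneg_coeffs a" "nonneg_coeffs b" "interlaces b a" "a + b \<noteq> 0"
  shows "sector_related (a + [:0, 1:] * b) (a + b)"
  unfolding sector_related_def
proof (intro allI impI)
  fix Y :: complex assume Y: "Y \<notin> \<real>\<^sub>\<le>\<^sub>0"
  let ?h = "a + [:0, 1:] * b" and ?g = "a + b"
  let ?T = "\<lambda>Y. poly (cpoly ?g) Y \<noteq> 0 \<and> (\<exists>\<alpha> \<beta>. 0 \<le> \<alpha> \<and> 0 \<le> \<beta> \<and> 0 < \<alpha> + \<beta> \<and>
      poly (cpoly ?h) Y = (of_real \<alpha> + of_real \<beta> * Y) * poly (cpoly ?g) Y)"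
  consider "Im Y > 0" | "Im Y < 0" | "Im Y = 0" by linarith
  then show "?T Y"
  proof cases
    case 1
    then show ?thesis using sector_related_upper[OF assms] by blast
  next
    case 2
    then have "Im (cnj Y) > 0" by simp
    then obtain \<alpha> \<beta> where *: "poly (cpoly ?g) (cnj Y) \<noteq> 0" "0 \<le> \<alpha>" "0 \<le> \<beta>" "0 < \<alpha> + \<beta>"
      "poly (cpoly ?h) (cnj Y) = (of_real \<alpha> + of_real \<beta> * cnj Y) * poly (cpoly ?g) (cnj Y)"
      using sector_related_upper[OF assms] by blast
    define H where "H = poly (cpoly ?h) Y"
    define G where "G = poly (cpoly ?g) Y"
    have "cnj (cnj H) = cnj ((of_real \<alpha> + of_real \<beta> * cnj Y) * cnj G)" "cnj G \<noteq> 0"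
      using *(1,5) unfolding cpoly_cnj H_def[symmetric] G_def[symmetric] by simp_all
    then have "H = (of_real \<alpha> + of_real \<beta> * Y) * G" "G \<noteq> 0" by simp_all
    then show ?thesis using *(2-4) unfolding H_def G_def by blast
  next
    case 3
    then obtain x where x: "Y = of_real x" "x > 0"
      using Y by (metis complex_nonpos_Reals_iff complex_of_real_def complex_surj not_le)
    have ge: "poly a x \<ge> 0" "poly b x \<ge> 0"
      using nonneg_coeffs_poly_pos[OF assms(1) _ x(2)] nonneg_coeffs_poly_pos[OF assms(2) _ x(2)]
      by (cases "a = 0"; cases "b = 0"; force)+
    have g: "poly ?g x > 0" using assms x by (intro nonneg_coeffs_poly_pos nonneg_coeffs_add)
    have h: "poly ?h x > 0"
    proof -
      have "poly a x + x * poly b x > 0" if "poly b x > 0" using that ge x by (simp add: add_nonneg_pos)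
      then show ?thesis using ge g x by (cases "poly b x > 0") auto
    qed
    show ?thesis unfolding x cpoly_of_real
    proof (intro conjI exI)
      show "complex_of_real (poly ?g x) \<noteq> 0" using g unfolding of_real_eq_0_iff by linarith
      \<comment> \<open>Here the ratio itself serves as \<alpha>, with \<beta> = 0.\<close>
      show "0 \<le> poly ?h x / poly ?g x" using g h by simp
      show "0 < poly ?h x / poly ?g x + 0" using g h by simp
      show "complex_of_real (poly ?h x) =
        (of_real (poly ?h x / poly ?g x) + of_real 0 * of_real x) * of_real (poly ?g x)"
        using g by (simp del: poly_add)
    qed simp
  qed
qed

lemma sector_relatedE:
  assumes "sector_related h g" "Y \<notin> \<real>\<^sub>\<le>\<^sub>0"
  obtains \<alpha> \<beta> where "poly (cpoly g) Y \<noteq> 0" "0 \<le> \<alpha>" "0 \<le> \<beta>" "0 < \<alpha> + \<beta>"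
    "poly (cpoly h) Y = (of_real \<alpha> + of_real \<beta> * Y) * poly (cpoly g) Y"
  using assms unfolding sector_related_def by blast

lemma cone_element_nonzero:
  fixes Y :: complex
  assumes "Y \<notin> \<real>\<^sub>\<le>\<^sub>0" "0 \<le> \<alpha>" "0 \<le> \<beta>" "0 < \<alpha> + \<beta>"
  shows "of_real \<alpha> + of_real \<beta> * Y \<noteq> 0"
proof
  assume 0: "of_real \<alpha> + of_real \<beta> * Y = 0"
  then have "\<alpha> + \<beta> * Re Y = 0" "\<beta> * Im Y = 0" by (simp_all add: complex_eq_iff)
  then have "\<beta> \<noteq> 0" using assms by auto
  then have "Im Y = 0" "Re Y = - \<alpha> / \<beta>"
    using \<open>\<beta> * Im Y = 0\<close> \<open>\<alpha> + \<beta> * Re Y = 0\<close> by (auto simp: field_simps)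
  then have "Y \<in> \<real>\<^sub>\<le>\<^sub>0" using assms by (simp add: complex_nonpos_Reals_iff)
  then show False using assms by simp
qed

lemma sector_related_nonzero:
  assumes "sector_related h g" "Y \<notin> \<real>\<^sub>\<le>\<^sub>0"
  shows "poly (cpoly h) Y \<noteq> 0" "poly (cpoly g) Y \<noteq> 0"
  using assms by (auto elim!: sector_relatedE dest: cone_element_nonzero[OF assms(2)])

text \<open>A nonpositive real product would force \<beta> = 0. Then the first factor is positive,
  so the second would be a nonpositive real, impossible for \<open>Z\<close> off that axis.\<close>

lemma cone_product_not_nonpos:
  assumes "Im Y > 0" "Im (Y * Z) > 0" "0 \<le> \<alpha>" "0 \<le> \<beta>" "0 < \<alpha> + \<beta>" "0 \<le> \<gamma>" "0 \<le> \<delta>" "0 < \<gamma> + \<delta>"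
    and Z: "Z \<notin> \<real>\<^sub>\<le>\<^sub>0"
  shows "(of_real \<alpha> + of_real \<beta> * Y) * (of_real \<gamma> + of_real \<delta> * Z) \<notin> \<real>\<^sub>\<le>\<^sub>0"
proof
  define u where "u = complex_of_real \<alpha> + of_real \<beta> * Y"
  define v where "v = complex_of_real \<gamma> + of_real \<delta> * Z"
  assume "(of_real \<alpha> + of_real \<beta> * Y) * (of_real \<gamma> + of_real \<delta> * Z) \<in> \<real>\<^sub>\<le>\<^sub>0"
  then have uv: "Re (u * v) \<le> 0" "Im (u * v) = 0" by (auto simp: complex_nonpos_Reals_iff u_def v_def)
  have v0: "v \<noteq> 0" unfolding v_def using Z assms by (intro cone_element_nonzero)
  have "\<beta> = 0"
  proof (cases "Im Z \<ge> 0")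
    case True
    have "Im (u * v) = \<beta> * \<gamma> * Im Y + \<alpha> * \<delta> * Im Z + \<beta> * \<delta> * Im (Y * Z)"
      by (simp add: u_def v_def algebra_simps)
    moreover have "\<beta> * \<gamma> * Im Y \<ge> 0" "\<alpha> * \<delta> * Im Z \<ge> 0" "\<beta> * \<delta> * Im (Y * Z) \<ge> 0"
      using assms True by auto
    ultimately have "\<beta> * \<gamma> * Im Y = 0" "\<beta> * \<delta> * Im (Y * Z) = 0" using uv by linarith+
    then have "\<beta> * \<gamma> = 0" "\<beta> * \<delta> = 0" using assms(1,2) by auto
    then show ?thesis using assms by auto
  next
    case False
    \<comment> \<open>Here \<open>u * v\<close> is a nonpositive real and
      \<open>Im v \<le> 0\<close>, so \<open>u\<close> times the squared modulus of \<open>v\<close>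
      has nonpositive imaginary part.\<close>
    have "Im (u * v * cnj v) = - (Re (u * v) * Im v)" using uv by (simp only: times_complex.sel) simp
    moreover have "Im (u * v * cnj v) = Im u * (cmod v)\<^sup>2"
      unfolding cmod_power2 by (simp add: algebra_simps power2_eq_square)
    moreover have "Im v \<le> 0" using False assms by (simp add: v_def mult_nonneg_nonpos)
    then have "Re (u * v) * Im v \<ge> 0" using uv by (intro mult_nonpos_nonpos)
    ultimately have "Im u * (cmod v)\<^sup>2 \<le> 0" by linarith
    then have "Im u \<le> 0" using v0 by (simp add: mult_le_0_iff)
    then show ?thesis using assms by (auto simp: u_def mult_le_0_iff)
  qed
  then have "\<alpha> > 0" "u = of_real \<alpha>" using assms by (auto simp: u_def)
  then have "Re v \<le> 0" "Im v = 0" using uv by (auto simp: mult_le_0_iff)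
  then have "\<gamma> + \<delta> * Re Z \<le> 0" "\<delta> * Im Z = 0" by (simp_all add: v_def)
  then have "\<delta> \<noteq> 0" using assms by auto
  then have "Im Z = 0" using \<open>\<delta> * Im Z = 0\<close> by simp
  then have "Re Z > 0" using Z by (auto simp: complex_nonpos_Reals_iff)
  then have "\<delta> * Re Z > 0" using \<open>\<delta> \<noteq> 0\<close> assms by simp
  then show False using \<open>\<gamma> + \<delta> * Re Z \<le> 0\<close> assms by linarith
qed

section \<open>Hadamard numerators in the upper half-plane\<close>

lemma convex_comb_nonzero:
  fixes P :: complex
  assumes "P \<notin> \<real>\<^sub>\<le>\<^sub>0" "0 \<le> t" "t \<le> 1"
  shows "of_real (1 - t) * P + of_real t \<noteq> 0"
proof
  assume 0: "of_real (1 - t) * P + of_real t = 0"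
  then have t: "t < 1" using assms by (cases "t = 1") auto
  have "(1 - t) * Re P + t = 0" "(1 - t) * Im P = 0" using 0 by (simp_all add: complex_eq_iff)
  then have "Re P = - t / (1 - t)" "Im P = 0" using t by (auto simp: field_simps)
  then have "P \<in> \<real>\<^sub>\<le>\<^sub>0" using t assms by (simp add: complex_nonpos_Reals_iff)
  then show False using assms by simp
qed

lemma not_nonpos_Reals_factor:
  assumes "Im Y > 0" "Y * Z = y" "Im y > 0"
  shows "Z \<notin> \<real>\<^sub>\<le>\<^sub>0"
proof
  assume "Z \<in> \<real>\<^sub>\<le>\<^sub>0"
  then have "Im y = Im Y * Re Z" "Re Z \<le> 0" using assms(2) by (auto simp: complex_nonpos_Reals_iff)
  then show False using assms by (simp add: mult_nonneg_nonpos not_less[symmetric] zero_less_mult_iff)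
qed

lemma upper_not_nonpos_Reals: "Im Y > 0 \<Longrightarrow> Y \<notin> \<real>\<^sub>\<le>\<^sub>0"
  by (auto simp: complex_nonpos_Reals_iff)

text \<open>The quotient of the two products at \<open>Y\<close> and \<open>Z\<close> is a product
  of cone elements, hence off the nonpositive axis, and the segment from it to 1 avoids 0.\<close>

lemma hadamard_num_convex_comb_nonzero:
  assumes "sector_related h h'" "sector_related k k'" "poly h 1 = poly h' 1"
    and deg: "degree h \<le> d" "degree h' \<le> d" "degree k \<le> e" "degree k' \<le> e"
    and y: "Im y > 0" and t: "0 \<le> t" "t \<le> 1"
  shows "of_real (1 - t) * poly (cpoly (hadamard_num d e h k)) y +
    of_real t * poly (cpoly (hadamard_num d e h' k')) y \<noteq> 0"
proof (rule hadamard_num_combination_nonzero[OF y deg])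
  fix Y Z assume YZ: "Im Y > 0" "Y * Z = y"
  have Z: "Z \<notin> \<real>\<^sub>\<le>\<^sub>0" using YZ y by (rule not_nonpos_Reals_factor)
  obtain \<alpha> \<beta> where h: "poly (cpoly h') Y \<noteq> 0" "0 \<le> \<alpha>" "0 \<le> \<beta>" "0 < \<alpha> + \<beta>"
    "poly (cpoly h) Y = (of_real \<alpha> + of_real \<beta> * Y) * poly (cpoly h') Y"
    using sector_relatedE[OF assms(1) upper_not_nonpos_Reals[OF YZ(1)]] by blast
  obtain \<gamma> \<delta> where k: "poly (cpoly k') Z \<noteq> 0" "0 \<le> \<gamma>" "0 \<le> \<delta>" "0 < \<gamma> + \<delta>"
    "poly (cpoly k) Z = (of_real \<gamma> + of_real \<delta> * Z) * poly (cpoly k') Z"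
    using sector_relatedE[OF assms(2) Z] by blast
  let ?P = "(of_real \<alpha> + of_real \<beta> * Y) * (of_real \<gamma> + of_real \<delta> * Z)"
  have "?P \<notin> \<real>\<^sub>\<le>\<^sub>0" using YZ y Z h k by (intro cone_product_not_nonpos) auto
  then have "of_real (1 - t) * ?P + of_real t \<noteq> 0" using t by (rule convex_comb_nonzero)
  moreover have "of_real (1 - t) * (poly (cpoly h) Y * poly (cpoly k) Z) +
      of_real t * (poly (cpoly h') Y * poly (cpoly k') Z) =
      (of_real (1 - t) * ?P + of_real t) * (poly (cpoly h') Y * poly (cpoly k') Z)"
    unfolding h k by (simp only: distrib_left distrib_right mult_ac add_ac)
  ultimately show "of_real (1 - t) * (poly (cpoly h) Y * poly (cpoly k) Z) +
      of_real t * (poly (cpoly h') Y * poly (cpoly k') Z) \<noteq> 0"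
    using h(1) k(1) by simp
next
  have y': "y \<notin> \<real>\<^sub>\<le>\<^sub>0" using y by (rule upper_not_nonpos_Reals)
  obtain \<gamma> \<delta> where k: "poly (cpoly k') y \<noteq> 0" "0 \<le> \<gamma>" "0 \<le> \<delta>" "0 < \<gamma> + \<delta>"
    "poly (cpoly k) y = (of_real \<gamma> + of_real \<delta> * y) * poly (cpoly k') y"
    using sector_relatedE[OF assms(2) y'] by blast
  have h1: "poly (cpoly h) 1 = poly (cpoly h') 1"
    using assms(3) cpoly_of_real[of h 1] cpoly_of_real[of h' 1] by simp
  have h1': "poly (cpoly h') 1 \<noteq> 0" using sector_related_nonzero[OF assms(1), of 1] by simp
  \<comment> \<open>As \<open>h\<close> and \<open>h'\<close> agree at 1, only the cone element of
    \<open>k\<close> remains; the cone lemma is used with second factor 1.\<close>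
  have "of_real \<gamma> + of_real \<delta> * y \<notin> \<real>\<^sub>\<le>\<^sub>0"
    using cone_product_not_nonpos[of y 1 \<gamma> \<delta> 1 0] k y by simp
  then have "of_real (1 - t) * (of_real \<gamma> + of_real \<delta> * y) + of_real t \<noteq> 0" using t by (rule convex_comb_nonzero)
  moreover have "of_real (1 - t) * (poly (cpoly h) 1 * poly (cpoly k) y) +
      of_real t * (poly (cpoly h') 1 * poly (cpoly k') y) =
      (of_real (1 - t) * (of_real \<gamma> + of_real \<delta> * y) + of_real t) * (poly (cpoly h') 1 * poly (cpoly k') y)"
    unfolding h1 k by (simp only: distrib_left distrib_right mult_ac add_ac)
  ultimately show "of_real (1 - t) * (poly (cpoly h) 1 * poly (cpoly k) y) +
      of_real t * (poly (cpoly h') 1 * poly (cpoly k') y) \<noteq> 0"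
    using k(1) h1' by simp
qed

text \<open>If the quotient \<open>c\<close> of the two numerators had negative imaginary part,
  \<open>\<alpha> + \<beta> * Y - c\<close> could not vanish, so the combination with weights 1 and
  \<open>- c\<close> would be nonzero, contrary to the choice of \<open>c\<close>.\<close>

lemma hadamard_num_Im_nonneg:
  assumes "sector_related h h'" "poly h 1 = poly h' 1"
    and g: "\<And>Z. Z \<notin> \<real>\<^sub>\<le>\<^sub>0 \<Longrightarrow> poly (cpoly g) Z \<noteq> 0"
    and deg: "degree h \<le> d" "degree h' \<le> d" "degree g \<le> e"
    and y: "Im y > 0"
  shows "poly (cpoly (hadamard_num d e h' g)) y \<noteq> 0"
    and "Im (poly (cpoly (hadamard_num d e h g)) y * cnj (poly (cpoly (hadamard_num d e h' g)) y)) \<ge> 0"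
proof -
  have h1: "poly (cpoly h) 1 = poly (cpoly h') 1"
    using assms(2) cpoly_of_real[of h 1] cpoly_of_real[of h' 1] by simp
  have h1': "poly (cpoly h') 1 \<noteq> 0" using sector_related_nonzero[OF assms(1), of 1] by simp
  have y': "y \<notin> \<real>\<^sub>\<le>\<^sub>0" using y by (rule upper_not_nonpos_Reals)
  have "0 * poly (cpoly (hadamard_num d e h g)) y + 1 * poly (cpoly (hadamard_num d e h' g)) y \<noteq> 0"
  proof (rule hadamard_num_combination_nonzero[OF y deg(1,2,3,3)])
    fix Y Z assume YZ: "Im Y > 0" "Y * Z = y"
    then show "0 * (poly (cpoly h) Y * poly (cpoly g) Z) + 1 * (poly (cpoly h') Y * poly (cpoly g) Z) \<noteq> 0"
      using sector_related_nonzero[OF assms(1)] g not_nonpos_Reals_factor[OF YZ y] upper_not_nonpos_Reals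
      by simp
  qed (use h1' g y' in simp)
  then show nz: "poly (cpoly (hadamard_num d e h' g)) y \<noteq> 0" by simp
  have *: "1 * poly (cpoly (hadamard_num d e h g)) y + (- c) * poly (cpoly (hadamard_num d e h' g)) y \<noteq> 0"
    if c: "Im c < 0" for c
  proof (rule hadamard_num_combination_nonzero[OF y deg(1,2,3,3)])
    fix Y Z assume YZ: "Im Y > 0" "Y * Z = y"
    obtain \<alpha> \<beta> where h: "poly (cpoly h') Y \<noteq> 0" "0 \<le> \<alpha>" "0 \<le> \<beta>" "0 < \<alpha> + \<beta>"
      "poly (cpoly h) Y = (of_real \<alpha> + of_real \<beta> * Y) * poly (cpoly h') Y"
      using sector_relatedE[OF assms(1) upper_not_nonpos_Reals[OF YZ(1)]] by blast
    have "0 \<le> \<beta> * Im Y" using h(3) YZ(1) by simp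
    moreover have "Im (of_real \<alpha> + of_real \<beta> * Y - c) = \<beta> * Im Y - Im c" by simp
    ultimately have "Im (of_real \<alpha> + of_real \<beta> * Y - c) > 0" using c by linarith
    then have "of_real \<alpha> + of_real \<beta> * Y - c \<noteq> 0" by (metis less_irrefl zero_complex.sel(2))
    moreover have "1 * (poly (cpoly h) Y * poly (cpoly g) Z) + (- c) * (poly (cpoly h') Y * poly (cpoly g) Z) =
        (of_real \<alpha> + of_real \<beta> * Y - c) * (poly (cpoly h') Y * poly (cpoly g) Z)"
      unfolding h by (simp add: algebra_simps)
    ultimately show "1 * (poly (cpoly h) Y * poly (cpoly g) Z) + (- c) * (poly (cpoly h') Y * poly (cpoly g) Z) \<noteq> 0"
      using h(1) g[OF not_nonpos_Reals_factor[OF YZ y]] by simp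
  next
    have "1 - c \<noteq> 0" using c by auto
    moreover have "1 * (poly (cpoly h) 1 * poly (cpoly g) y) + (- c) * (poly (cpoly h') 1 * poly (cpoly g) y) =
        (1 - c) * (poly (cpoly h') 1 * poly (cpoly g) y)"
      unfolding h1 by (simp add: algebra_simps)
    ultimately show "1 * (poly (cpoly h) 1 * poly (cpoly g) y) + (- c) * (poly (cpoly h') 1 * poly (cpoly g) y) \<noteq> 0"
      using h1' g[OF y'] by simp
  qed
  define c where "c = poly (cpoly (hadamard_num d e h g)) y / poly (cpoly (hadamard_num d e h' g)) y"
  have eq: "poly (cpoly (hadamard_num d e h g)) y = c * poly (cpoly (hadamard_num d e h' g)) y"
    using nz by (simp add: c_def)
  then have "Im c \<ge> 0" using *[of c] by (cases "Im c < 0") auto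
  moreover have "Im (c * z * cnj z) = Im c * (cmod z)\<^sup>2" for z
    unfolding cmod_power2 by (simp add: algebra_simps power2_eq_square)
  ultimately show "Im (poly (cpoly (hadamard_num d e h g)) y * cnj (poly (cpoly (hadamard_num d e h' g)) y)) \<ge> 0"
    unfolding eq by simp
qed

section \<open>Combining interlacing relations\<close>

text \<open>The two hypotheses only bound the argument of \<open>P / Q\<close> by \<open>2\<pi>\<close>; since it is continuous, small far to
  the right, and never equal to \<open>\<pi>\<close> by the condition on convex combinations, it stays below \<open>\<pi>\<close>.\<close>

lemma Im_nonneg_trans:
  assumes "real_rooted P" "lead_coeff P > 0" "real_rooted M" "lead_coeff M > 0" "real_rooted Q" "lead_coeff Q > 0"
    and PM: "\<And>Y. Im Y > 0 \<Longrightarrow> Im (poly (cpoly P) Y * cnj (poly (cpoly M) Y)) \<ge> 0"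
    and MQ: "\<And>Y. Im Y > 0 \<Longrightarrow> Im (poly (cpoly M) Y * cnj (poly (cpoly Q) Y)) \<ge> 0"
    and comb: "\<And>Y t. Im Y > 0 \<Longrightarrow> 0 \<le> t \<Longrightarrow> t \<le> 1 \<Longrightarrow>
      of_real (1 - t) * poly (cpoly P) Y + of_real t * poly (cpoly Q) Y \<noteq> 0"
    and Y: "Im Y > 0"
  shows "Im (poly (cpoly P) Y * cnj (poly (cpoly Q) Y)) \<ge> 0"
proof -
  define g where "g Y = angs Y (zeros_desc P) - angs Y (zeros_desc Q)" for Y
  have cont: "continuous_on {Y. Im Y > 0} g"
    unfolding g_def by (intro continuous_intros continuous_on_angs)
  have ne: "g Z \<noteq> pi" if Z: "Im Z > 0" for Z
  proof
    assume pi: "g Z = pi"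
    obtain \<rho> where \<rho>: "\<rho> > 0" "poly (cpoly P) Z = of_real \<rho> * cis (angs Z (zeros_desc P))"
      using real_rooted_polar[OF assms(1,2) Z] by blast
    obtain \<sigma> where \<sigma>: "\<sigma> > 0" "poly (cpoly Q) Z = of_real \<sigma> * cis (angs Z (zeros_desc Q))"
      using real_rooted_polar[OF assms(5,6) Z] by blast
    have "angs Z (zeros_desc P) = angs Z (zeros_desc Q) + pi" using pi by (simp add: g_def)
    then have P: "poly (cpoly P) Z = - (of_real \<rho> * cis (angs Z (zeros_desc Q)))"
      by (simp add: \<rho>(2) cis_mult[symmetric])
    \<comment> \<open>\<open>P\<close> and \<open>Q\<close> point in opposite directions at
      \<open>Z\<close>; this weight balances their moduli, so the combination cancels.\<close>
    define t where "t = \<rho> / (\<rho> + \<sigma>)"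
    have t: "0 \<le> t" "t \<le> 1" "(1 - t) * \<rho> = t * \<sigma>" using \<rho>(1) \<sigma>(1) by (auto simp: t_def field_simps)
    have "of_real (1 - t) * poly (cpoly P) Z + of_real t * poly (cpoly Q) Z =
        of_real (t * \<sigma> - (1 - t) * \<rho>) * cis (angs Z (zeros_desc Q))"
      unfolding P \<sigma>(2) by (simp add: algebra_simps)
    also have "\<dots> = 0" using t(3) by simp
    finally show False using comb[OF Z t(1,2)] by simp
  qed
  obtain Y0 where Y0: "Im Y0 > 0" "\<bar>g Y0\<bar> < pi"
    using ex_angs_small[of pi "zeros_desc P" "zeros_desc Q"] by (auto simp: g_def)
  have "g Y < pi"
  proof (rule ccontr)
    assume "\<not> g Y < pi"
    then have "\<exists>Z. Im Z > 0 \<and> g Z = pi"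
      using Y0 Y by (intro upper_halfplane_IVT[OF cont Y0(1) Y]) auto
    then show False using ne by blast
  qed
  \<comment> \<open>Passing through \<open>M\<close> gives the lower bound 0 for
    \<open>g Y\<close>.\<close>
  moreover have "angs Y (zeros_desc M) \<le> angs Y (zeros_desc P)"
    using angs_interlacing[OF Im_nonneg_imp_interlacing[OF assms(1-4) PM] Y] by simp
  moreover have "angs Y (zeros_desc Q) \<le> angs Y (zeros_desc M)"
    using angs_interlacing[OF Im_nonneg_imp_interlacing[OF assms(3-6) MQ] Y] by simp
  ultimately have "sin (g Y) \<ge> 0" by (intro sin_ge_zero) (auto simp: g_def)
  moreover obtain \<rho> where \<rho>: "\<rho> > 0" "poly (cpoly P) Y = of_real \<rho> * cis (angs Y (zeros_desc P))"
    using real_rooted_polar[OF assms(1,2) Y] by blast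
  moreover obtain \<sigma> where \<sigma>: "\<sigma> > 0" "poly (cpoly Q) Y = of_real \<sigma> * cis (angs Y (zeros_desc Q))"
    using real_rooted_polar[OF assms(5,6) Y] by blast
  ultimately show ?thesis unfolding \<rho>(2) \<sigma>(2) Im_mult_cnj_polar by (simp add: g_def)
qed

text \<open>Where \<open>P\<close> and \<open>Q\<close> agree, the argument difference is a multiple
  of \<pi> in the range from 0 to below \<pi>, hence 0. Then all zeros coincide, and the common
  nonzero value at 1 forces \<open>P = Q\<close>.\<close>

lemma difference_nonzero:
  assumes "real_rooted P" "lead_coeff P > 0" "real_rooted Q" "lead_coeff Q > 0"
    and "interlacing (zeros_desc Q) (zeros_desc P)"
    and "poly P 1 = poly Q 1" "poly Q 1 \<noteq> 0" "P \<noteq> Q" "Im Y > 0"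
  shows "poly (cpoly (P - Q)) Y \<noteq> 0"
proof
  assume "poly (cpoly (P - Q)) Y = 0"
  then have eq: "poly (cpoly P) Y = poly (cpoly Q) Y" by simp
  let ?g = "angs Y (zeros_desc P) - angs Y (zeros_desc Q)"
  obtain \<rho> where \<rho>: "\<rho> > 0" "poly (cpoly P) Y = of_real \<rho> * cis (angs Y (zeros_desc P))"
    using real_rooted_polar[OF assms(1,2,9)] by blast
  obtain \<sigma> where \<sigma>: "\<sigma> > 0" "poly (cpoly Q) Y = of_real \<sigma> * cis (angs Y (zeros_desc Q))"
    using real_rooted_polar[OF assms(3,4,9)] by blast
  have "Im (poly (cpoly P) Y * cnj (poly (cpoly Q) Y)) = 0"
    unfolding eq by (simp only: complex_mult_cnj Im_complex_of_real)
  then have "sin ?g = 0" using \<rho>(1) \<sigma>(1) unfolding \<rho>(2) \<sigma>(2) Im_mult_cnj_polar by simp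
  moreover have "0 \<le> ?g" "?g < pi"
    using angs_interlacing[OF assms(5,9)] ang_bounds(2)[of Y "hd (zeros_desc P)"]
    by (auto split: if_splits)
  ultimately have "?g = 0" using sin_gt_zero[of ?g] by linarith
  then have zz: "zeros_desc P = zeros_desc Q" using angs_interlacing[OF assms(5,9)] by simp
  define R where "R = (\<Prod>z\<leftarrow>zeros_desc Q. [:-z, 1:])"
  have "P \<noteq> 0" "Q \<noteq> 0" using assms by auto
  then have PR: "P = smult (lead_coeff P) R" and QR: "Q = smult (lead_coeff Q) R"
    using real_rooted_factor[OF assms(1)] real_rooted_factor[OF assms(3)] by (simp_all add: R_def zz)
  have "lead_coeff P * poly R 1 = poly P 1" "lead_coeff Q * poly R 1 = poly Q 1"
    by (metis PR poly_smult, metis QR poly_smult)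
  then have "lead_coeff P = lead_coeff Q" using assms(6,7) by (metis mult_cancel_right mult_zero_right)
  then show False using PR QR assms(8) by simp
qed

lemma nth_le_of_interlacing:
  assumes "interlacing r s" "\<forall>z\<in>set s. z \<le> (c :: real)" "z \<in> set r"
  shows "z \<le> c"
proof -
  obtain i where i: "i < length r" "z = r ! i" using assms(3) by (metis in_set_conv_nth)
  then have "r ! i \<le> s ! i" "i < length s" using assms(1) by (auto simp: interlacing_def)
  then show ?thesis using assms(2) i by (meson nth_mem order_trans)
qed

text \<open>All zeros of \<open>Q\<close> are nonpositive, so the zero \<open>1\<close> of \<open>P - Q\<close> has to be its largest one.\<close>

lemma quotient_interlacing:
  assumes "real_rooted P" "nonneg_coeffs P" "P \<noteq> 0" "real_rooted Q" "nonneg_coeffs Q" "Q \<noteq> 0"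
    and il: "interlacing (zeros_desc Q) (zeros_desc P)"
    and c: "P - Q = [:-1, 1:] * c" "c \<noteq> 0"
  shows "nonneg_coeffs c" "real_rooted c" "interlacing (zeros_desc c) (zeros_desc Q)"
proof -
  define V where "V = P - Q"
  have Vc: "V = [:-1, 1:] * c" using c V_def by simp
  have V0: "V \<noteq> 0" using c(2) by (simp add: Vc del: mult_pCons_left)
  have V1: "poly V 1 = 0" by (simp add: Vc)
  have lead: "lead_coeff P > 0" "lead_coeff Q > 0" using assms nonneg_coeffs_lead_pos by auto
  have Vnz: "poly (cpoly V) Y \<noteq> 0" if "Im Y > 0" for Y
    unfolding V_def
  proof (rule difference_nonzero)
    show "poly P 1 = poly Q 1" using V1 by (simp add: V_def)
    show "poly Q 1 \<noteq> 0" using nonneg_coeffs_poly_pos[of Q 1] assms by simp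
    show "P \<noteq> Q" using V0 by (simp add: V_def)
  qed (use assms lead that in auto)
  then have rrV: "real_rooted V" using V0 by (simp add: real_rooted_iff)
  show rrc: "real_rooted c" using Vnz c(2) unfolding Vc by (auto simp: real_rooted_iff simp del: mult_pCons_left)
  have Qnp: "\<forall>z\<in>set (zeros_desc Q). z \<le> 0" using zeros_desc_nonpos assms by blast
  have ImV: "Im (poly (cpoly V) Y * cnj (poly (cpoly Q) Y)) \<ge> 0" if "Im Y > 0" for Y
  proof -
    \<comment> \<open>The two products differ by a squared modulus, which is real.\<close>
    have "Im (poly (cpoly V) Y * cnj (poly (cpoly Q) Y)) = Im (poly (cpoly P) Y * cnj (poly (cpoly Q) Y))"
      by (simp add: V_def algebra_simps)
    then show ?thesis using interlacing_imp_Im_nonneg[OF assms(1) lead(1) assms(4) lead(2) il that] by simp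
  qed
  have leadV: "lead_coeff V > 0"
  proof (rule ccontr)
    assume "\<not> lead_coeff V > 0"
    then have "lead_coeff V < 0" using V0 by (metis leading_coeff_0_iff linorder_neqE_linordered_idom)
    then have neg: "lead_coeff (- V) > 0" by simp
    \<comment> \<open>A negative leading coefficient would place the zeros of \<open>V\<close> below
      those of \<open>Q\<close>, excluding the zero 1.\<close>
    have "interlacing (zeros_desc (- V)) (zeros_desc Q)"
    proof (rule Im_nonneg_imp_interlacing[OF assms(4) lead(2) _ neg])
      show "real_rooted (- V)" using Vnz V0 by (simp add: real_rooted_iff)
      show "Im (poly (cpoly Q) Y * cnj (poly (cpoly (- V)) Y)) \<ge> 0" if "Im Y > 0" for Y
        using ImV[OF that] by (simp add: algebra_simps)
    qed
    moreover have "1 \<in> set (zeros_desc (- V))" using V0 V1 by (simp add: set_zeros_desc)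
    ultimately show False using nth_le_of_interlacing[OF _ Qnp] by force
  qed
  have ilV: "interlacing (zeros_desc Q) (zeros_desc V)"
    using Im_nonneg_imp_interlacing[OF rrV leadV assms(4) lead(2) ImV] by simp
  have one: "1 \<in> set (zeros_desc V)" using V0 V1 by (simp add: set_zeros_desc)
  then obtain v vs where v: "zeros_desc V = v # vs" by (cases "zeros_desc V") auto
  have ilvs: "interlacing vs (zeros_desc Q)" using ilV by (simp add: v interlacing_Cons)
  have vsnp: "\<forall>z\<in>set vs. z \<le> 0" using nth_le_of_interlacing[OF ilvs Qnp] by blast
  then have "v = 1" using one v by fastforce
  have "[:-1, 1:] * c = smult (lead_coeff V) (\<Prod>z\<leftarrow>zeros_desc V. [:-z, 1:])"
    using real_rooted_factor[OF rrV V0] Vc by simp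
  also have "\<dots> = [:-1, 1:] * smult (lead_coeff V) (\<Prod>z\<leftarrow>vs. [:-z, 1:])"
    unfolding v \<open>v = 1\<close> by (simp only: list.map prod_list.Cons mult_smult_right)
  finally have ceq: "c = smult (lead_coeff V) (\<Prod>z\<leftarrow>vs. [:-z, 1:])"
    by (subst (asm) mult_left_cancel) simp_all
  show "nonneg_coeffs c"
    unfolding ceq using nonneg_coeffs_prod_linear[OF vsnp] leadV by (simp add: nonneg_coeffs_def)
  have "sorted_wrt (\<ge>) vs" using sorted_zeros_desc[of V] by (simp add: v)
  then have "zeros_desc c = vs" unfolding ceq using leadV by (intro zeros_desc_prod_linear) auto
  then show "interlacing (zeros_desc c) (zeros_desc Q)" using ilvs by simp
qed

section \<open>Recovering the symmetric decomposition from the reversal\<close>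

lemma symmetric_decomposition_recip:
  assumes "symmetric_decomposition d h a b"
  shows "h = a + [:0, 1:] * b" "recip_poly d h = a + b"
proof -
  show h: "h = a + [:0, 1:] * b" using assms by (simp add: symmetric_decomposition_def)
  \<comment> \<open>Multiplication by \<open>x\<close> shifts coefficients, so reversal at
    \<open>d\<close> acts on \<open>x b\<close> as reversal at \<open>d - 1\<close> acts on
    \<open>b\<close>. The case \<open>b = 0\<close> covers \<open>d = 0\<close>, where
    \<open>d - 1\<close> truncates.\<close>
  have "recip_poly d ([:0, 1:] * b) = b"
  proof (cases "b = 0")
    case True
    then show ?thesis by (simp add: recip_poly_def)
  next
    case False
    then have b: "degree b < d" "recip_poly (d - 1) b = b" using assms by (auto simp: symmetric_decomposition_def)
    show ?thesis
    proof (rule poly_eqI)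
      fix n
      have "coeff (recip_poly d ([:0, 1:] * b)) n = coeff (recip_poly (d - 1) b) n"
      proof (cases "n < d")
        case True
        then have "d - n = Suc (d - 1 - n)" by simp
        then show ?thesis using True by (simp add: coeff_recip_poly)
      next
        case False
        then show ?thesis using b(1) by (auto simp: coeff_recip_poly)
      qed
      then show "coeff (recip_poly d ([:0, 1:] * b)) n = coeff b n" using b by simp
    qed
  qed
  moreover have "recip_poly d a = a" using assms by (simp add: symmetric_decomposition_def)
  ultimately show "recip_poly d h = a + b" unfolding h by (simp only: recip_poly_add)
qed

text \<open>The components are the quotients of \<open>x W' - W\<close> and \<open>W - W'\<close> by
  \<open>x - 1\<close>, where \<open>W'\<close> is the reversal; \<open>quotient_interlacing\<close>
  handles both.\<close>

lemma nonneg_interlacing_decompositionI: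
  assumes "degree W \<le> d" "W \<noteq> 0" "nonneg_coeffs W" "real_rooted W"
    and W': "real_rooted (recip_poly d W)" "recip_poly d W \<noteq> 0"
    and Im: "\<And>Y. Im Y > 0 \<Longrightarrow> Im (poly (cpoly W) Y * cnj (poly (cpoly (recip_poly d W)) Y)) \<ge> 0"
  shows "nonneg_interlacing_decomposition d W"
proof -
  define W' where "W' = recip_poly d W"
  obtain a b where ab: "symmetric_decomposition d W a b"
    using symmetric_decomposition_exists[OF assms(1)] by blast
  have W: "W = a + [:0, 1:] * b" and Wr: "W' = a + b"
    using symmetric_decomposition_recip[OF ab] by (simp_all add: W'_def)
  have nn: "nonneg_coeffs W'" unfolding W'_def using assms(3) by (rule nonneg_coeffs_recip_poly)
  have r: "real_rooted W'" "W' \<noteq> 0" using W' by (simp_all add: W'_def)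
  have lead: "lead_coeff W > 0" "lead_coeff W' > 0" using nonneg_coeffs_lead_pos assms nn r by auto
  have il: "interlacing (zeros_desc W') (zeros_desc W)"
    using Im by (intro Im_nonneg_imp_interlacing assms r lead) (simp add: W'_def)
  have np: "\<forall>z\<in>set (zeros_desc W). z \<le> 0" "\<forall>z\<in>set (zeros_desc W'). z \<le> 0"
    using zeros_desc_nonpos assms nn r by blast+
  have b: "nonneg_coeffs b \<and> real_rooted b \<and> (b \<noteq> 0 \<longrightarrow> interlacing (zeros_desc b) (zeros_desc W'))"
  proof (cases "b = 0")
    case True
    then show ?thesis by (simp add: nonneg_coeffs_def real_rooted_def)
  next
    case False
    have "W - W' = [:-1, 1:] * b" by (simp add: W Wr)
    then show ?thesis
      using quotient_interlacing[OF assms(4,3,2) r(1) nn r(2) il] False by blast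
  qed
  have a: "nonneg_coeffs a \<and> real_rooted a"
  proof (cases "a = 0")
    case True
    then show ?thesis by (simp add: nonneg_coeffs_def real_rooted_def)
  next
    case False
    let ?P = "[:0, 1:] * W'"
    have "?P - W = [:-1, 1:] * a" by (simp add: W Wr)
    moreover have "interlacing (zeros_desc W) (zeros_desc ?P)"
      unfolding zeros_desc_X_mult[OF r np(2)] using il np(1) by (simp add: interlacing_Cons)
    moreover have "real_rooted ?P" using r by (intro real_rooted_mult real_rooted_X) auto
    moreover have "nonneg_coeffs ?P" using nn nonneg_coeffs_linear[of 0] by (intro nonneg_coeffs_mult) auto
    moreover have "?P \<noteq> 0" using r by simp
    ultimately show ?thesis
      using quotient_interlacing[of ?P W a] assms False by blast
  qed
  have "interlaces b a"
  proof (cases "a = 0 \<or> b = 0")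
    case True
    then show ?thesis using a b by (auto simp: interlaces_altdef)
  next
    case False
    have leads: "lead_coeff a > 0" "lead_coeff b > 0" using False a b nonneg_coeffs_lead_pos by auto
    have "interlacing (zeros_desc b) (zeros_desc a)"
    proof (rule Im_nonneg_imp_interlacing)
      fix Y assume Y: "Im Y > 0"
      \<comment> \<open>As \<open>W' = a + b\<close>, replacing \<open>W'\<close> by
        \<open>a\<close> changes this product only by a real squared modulus.\<close>
      have "Im (poly (cpoly W') Y * cnj (poly (cpoly b) Y)) \<ge> 0"
        using r lead b leads False Y by (intro interlacing_imp_Im_nonneg) auto
      then show "Im (poly (cpoly a) Y * cnj (poly (cpoly b) Y)) \<ge> 0"
        by (simp add: Wr algebra_simps)
    qed (use a b leads in auto)
    then show ?thesis using a b by (auto simp: interlaces_altdef)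
  qed
  then show ?thesis using ab a b unfolding nonneg_interlacing_decomposition_def by blast
qed

section \<open>Numerators of products of polynomials\<close>

lemma W_poly_nonzero:
  assumes "p \<noteq> 0"
  shows "W_poly p \<noteq> 0"
proof
  assume "W_poly p = 0"
  then have "poly p (of_nat n) = 0" for n
    by (simp add: poly_eq_num_seq_W_poly num_seq_def)
  then have "range real \<subseteq> {x. poly p x = 0}" by auto
  moreover have "infinite (range real)" by (simp add: finite_image_iff inj_on_def)
  ultimately show False using poly_roots_finite[OF assms] finite_subset by blast
qed

lemma decomposition_sector:
  assumes "nonneg_interlacing_decomposition d h" "h \<noteq> 0" "degree h \<le> d"
  shows "nonneg_coeffs h" "nonneg_coeffs (recip_poly d h)" "sector_related h (recip_poly d h)"
    "poly h 1 = poly (recip_poly d h) 1" "degree (recip_poly d h) \<le> d"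
proof -
  obtain a b where ab: "symmetric_decomposition d h a b" "nonneg_coeffs a" "nonneg_coeffs b" "interlaces b a"
    using assms(1) by (auto simp: nonneg_interlacing_decomposition_def)
  have h: "h = a + [:0, 1:] * b" and r: "recip_poly d h = a + b"
    using symmetric_decomposition_recip[OF ab(1)] by auto
  have "a + b \<noteq> 0"
  proof
    assume "a + b = 0"
    then have "\<forall>i. coeff a i + coeff b i = 0" by (metis coeff_0 coeff_add)
    then have "\<forall>i. coeff a i = 0 \<and> coeff b i = 0"
      using ab(2,3) by (metis add_nonneg_eq_0_iff nonneg_coeffs_def)
    then have "a = 0" "b = 0" by (simp_all add: poly_eq_iff)
    then show False using assms(2) h by simp
  qed
  then show "sector_related h (recip_poly d h)"
    unfolding r unfolding h using ab by (intro sector_related_decomposition)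
  show "nonneg_coeffs (recip_poly d h)" unfolding r using ab by (intro nonneg_coeffs_add)
  show "nonneg_coeffs h" unfolding h
    using ab nonneg_coeffs_linear[of 0] by (intro nonneg_coeffs_add nonneg_coeffs_mult) auto
  show "poly h 1 = poly (recip_poly d h) 1" unfolding r by (simp add: h)
  show "degree (recip_poly d h) \<le> d" by (rule degree_le) (simp add: coeff_recip_poly)
qed

theorem theorem1p5:
  fixes p q :: "real poly"
  assumes "nonneg_interlacing_decomposition (degree p) (W_poly p)"
    and "nonneg_interlacing_decomposition (degree q) (W_poly q)"
  shows "nonneg_interlacing_decomposition (degree (p * q)) (W_poly (p * q))"
proof (cases "p = 0 \<or> q = 0")
  case True
  \<comment> \<open>If a factor is 0, so is the product, and the claim is the hypothesis on that
    factor.\<close>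
  then show ?thesis using assms by auto
next
  case False
  then have pq: "p \<noteq> 0" "q \<noteq> 0" by auto
  define d where "d = degree p"
  define e where "e = degree q"
  define h where "h = W_poly p"
  define k where "k = W_poly q"
  define h' where "h' = recip_poly d h"
  define k' where "k' = recip_poly e k"
  have deg: "degree h \<le> d" "degree k \<le> e" by (simp_all add: h_def k_def d_def e_def degree_W_poly)
  note H = decomposition_sector[OF assms(1) W_poly_nonzero[OF pq(1)] degree_W_poly,
      folded d_def h_def, folded h'_def]
  note K = decomposition_sector[OF assms(2) W_poly_nonzero[OF pq(2)] degree_W_poly,
      folded e_def k_def, folded k'_def]
  define W where "W = hadamard_num d e h k"
  \<comment> \<open>The intermediate numerator: from \<open>W\<close> to \<open>M\<close> only the
    first factor is reversed, from \<open>M\<close> to \<open>W'\<close> only the second.\<close>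
  define M where "M = hadamard_num d e h' k"
  define W' where "W' = hadamard_num d e h' k'"
  have comm: "M = hadamard_num e d k h'" "W' = hadamard_num e d k' h'"
    by (simp_all add: M_def W'_def hadamard_num_commute)
  have comb: "of_real (1 - t) * poly (cpoly W) Y + of_real t * poly (cpoly W') Y \<noteq> 0"
    if "Im Y > 0" "0 \<le> t" "t \<le> 1" for Y t
    unfolding W_def W'_def
    using H(3) K(3) H(4) deg(1) H(5) deg(2) K(5) that by (rule hadamard_num_convex_comb_nonzero)
  have nzW: "poly (cpoly W) Y \<noteq> 0" and nzW': "poly (cpoly W') Y \<noteq> 0" if "Im Y > 0" for Y
    using comb[OF that, of 0] comb[OF that, of 1] by simp_all
  have nzM: "poly (cpoly M) Y \<noteq> 0" and WM: "Im (poly (cpoly W) Y * cnj (poly (cpoly M) Y)) \<ge> 0"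
    if "Im Y > 0" for Y
    unfolding W_def M_def
    using hadamard_num_Im_nonneg[OF H(3,4) sector_related_nonzero(1)[OF K(3)] deg(1) H(5) deg(2) that] by auto
  \<comment> \<open>\<open>hadamard_num_Im_nonneg\<close> varies the first argument, so the
    arguments are exchanged first.\<close>
  have MW': "Im (poly (cpoly M) Y * cnj (poly (cpoly W') Y)) \<ge> 0" if "Im Y > 0" for Y
    unfolding comm
    using hadamard_num_Im_nonneg[OF K(3,4) sector_related_nonzero(2)[OF H(3)] deg(2) K(5) H(5) that] by auto
  have ne: "W \<noteq> 0" "M \<noteq> 0" "W' \<noteq> 0" using nzW[of \<i>] nzM[of \<i>] nzW'[of \<i>] by auto
  have rr: "real_rooted W" "real_rooted M" "real_rooted W'"
    using nzW nzM nzW' ne by (simp_all add: real_rooted_iff)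
  have nn: "nonneg_coeffs W" "nonneg_coeffs M" "nonneg_coeffs W'"
    unfolding W_def M_def W'_def using H(1,2) K(1,2) by (intro nonneg_coeffs_hadamard_num; simp)+
  have lead: "lead_coeff W > 0" "lead_coeff M > 0" "lead_coeff W' > 0"
    using nn ne nonneg_coeffs_lead_pos by auto
  have W'r: "recip_poly (d + e) W = W'"
    by (simp add: W_def W'_def h'_def k'_def recip_poly_hadamard_num)
  have "nonneg_interlacing_decomposition (d + e) W"
  proof (rule nonneg_interlacing_decompositionI)
    show "degree W \<le> d + e" by (simp add: W_def degree_hadamard_num)
    show "Im (poly (cpoly W) Y * cnj (poly (cpoly (recip_poly (d + e) W)) Y)) \<ge> 0" if "Im Y > 0" for Y
      unfolding W'r
      by (rule Im_nonneg_trans[OF rr(1) lead(1) rr(2) lead(2) rr(3) lead(3) WM MW' comb that])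
  qed (use rr ne nn W'r in auto)
  moreover have "degree (p * q) = d + e" using pq by (simp add: degree_mult_eq d_def e_def)
  moreover have "W_poly (p * q) = W"
    using W_poly_mult[OF pq] by (simp add: W_def d_def e_def h_def k_def)
  ultimately show ?thesis by simp
qed

end
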